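(* Let $\mathcal{X}\subset\mathbb{R}/\mathbb{Z}$ be a finite set. Let $N\ge z_0\ge 2$ be two real parameters and define $P(z_0)=\prod_{p<z_0}p$. For $z\ge 1$ set $$\delta_*(z,z_0)=\min\biggl\{\Bigl\|\sum_{x\in\mathcal{A}}x-\sum_{x\in\mathcal{B}}x-\frac{a}{q}\Bigr\|_{\mathbb{R}/\mathbb{Z}}:\ \mathcal{A},\mathcal{B}\subset\mathcal{X},\ \mathcal{A}\neq\mathcal{B},\ a\in\mathbb{Z},\ q\le z,\ (q,P(z_0))=1\biggr\}.$$ Let $\kappa\in(0,1/2]$ and assume that $\delta_*(N^\kappa,z_0)>0$. For any complex-valued function $f$ with support inside a nonempty subset $S$ of the primes of $\{N^\kappa,\ldots,N\}$ (that is, primes $p$ with $N^\kappa\le p\le N$), we have $$\sum_{x\in\mathcal{X}}\biggl|\sum_{p\le N}f(p)e(xp)\biggr|^2\le c(\kappa)\,|S|\,\|f\|_2^2\,\log\frac{8N}{|S|\log N},$$ where $$c(\kappa)=9\,\frac{\log\Bigl(64\,\dfrac{N+\delta_*(N^\kappa,z_0)^{-1}}{\kappa|S|\log N}\,\log z_0\Bigr)}{\log\dfrac{8N}{|S|\log N}}.$$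
   Context: Notation: the letter $p$ denotes a prime; $q$ ranges over positive integers; $(q,P(z_0))$ is the greatest common divisor; an empty product equals $1$. $e(y)=\exp(2i\pi y)$; $\|f\|_2^2=\sum_n|f(n)|^2$; for $u\in\mathbb{R}/\mathbb{Z}$, $\|u\|_{\mathbb{R}/\mathbb{Z}}=\min_{k\in\mathbb{Z}}|u-k|$; $|S|$ is the cardinality of $S$. *)

theory Defs
  imports Complex_Main "HOL-Computational_Algebra.Primes" "HOL-Library.Extended_Real"
begin

quotient_type real_mod_one = real / "\<lambda>x y :: real. x - y \<in> \<int>"
  morphisms rep_mod_one to_mod_one
proof (rule equivpI)
  show "reflp (\<lambda>x y :: real. x - y \<in> \<int>)"
    by (simp add: reflp_def)
  show "symp (\<lambda>x y :: real. x - y \<in> \<int>)"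
    by (metis (no_types, lifting) Ints_minus minus_diff_eq sympI)
  show "transp (\<lambda>x y :: real. x - y \<in> \<int>)"
  proof (rule transpI)
    fix x y z :: real
    assume "x - y \<in> \<int>" "y - z \<in> \<int>"
    then have "(x - y) + (y - z) \<in> \<int>" by (rule Ints_add)
    then show "x - z \<in> \<int>" by simp
  qed
qed

instantiation real_mod_one :: ab_group_add
begin

lift_definition zero_real_mod_one :: real_mod_one is "0 :: real" .

lift_definition plus_real_mod_one :: "real_mod_one \<Rightarrow> real_mod_one \<Rightarrow> real_mod_one"
  is "(+)"
proof -
  fix a b c d :: real
  assume "a - b \<in> \<int>" "c - d \<in> \<int>"
  then have "(a - b) + (c - d) \<in> \<int>" by (rule Ints_add)
  then show "(a + c) - (b + d) \<in> \<int>" by (simp add: algebra_simps)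
qed

lift_definition uminus_real_mod_one :: "real_mod_one \<Rightarrow> real_mod_one"
  is "uminus"
proof -
  fix a b :: real
  assume "a - b \<in> \<int>"
  then have "- (a - b) \<in> \<int>" by (rule Ints_minus)
  then show "- a - - b \<in> \<int>" by simp
qed

lift_definition minus_real_mod_one :: "real_mod_one \<Rightarrow> real_mod_one \<Rightarrow> real_mod_one"
  is "(-)"
proof -
  fix a b c d :: real
  assume "a - b \<in> \<int>" "c - d \<in> \<int>"
  then have "(a - b) - (c - d) \<in> \<int>" by (rule Ints_diff)
  then show "(a - c) - (b - d) \<in> \<int>" by (simp add: algebra_simps)
qed

instance
  by standard (transfer; simp)+

end

lift_definition nat_mult :: "nat \<Rightarrow> real_mod_one \<Rightarrow> real_mod_one"
  is "\<lambda>n x. real n * x"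
proof -
  fix n :: nat and a b :: real
  assume "a - b \<in> \<int>"
  then have "real n * (a - b) \<in> \<int>" by (intro Ints_mult) auto
  then show "real n * a - real n * b \<in> \<int>" by (simp add: algebra_simps)
qed

lift_definition dist_to_zero :: "real_mod_one \<Rightarrow> real"
  is "\<lambda>u. INF k :: int. \<bar>u - of_int k\<bar>"
proof -
  fix a b :: real
  assume "a - b \<in> \<int>"
  then obtain m :: int where "a - b = of_int m" by (elim Ints_cases)
  then have m: "a = b + of_int m" by simp
  have "range (\<lambda>k :: int. \<bar>a - of_int k\<bar>) = range (\<lambda>k :: int. \<bar>b - of_int k\<bar>)"
  proof (intro equalityI image_subsetI)
    fix k :: int
    have "\<bar>a - of_int k\<bar> = \<bar>b - of_int (k - m)\<bar>" by (simp add: m)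
    then show "\<bar>a - of_int k\<bar> \<in> range (\<lambda>k :: int. \<bar>b - of_int k\<bar>)" by blast
    have "\<bar>b - of_int k\<bar> = \<bar>a - of_int (k + m)\<bar>" by (simp add: m)
    then show "\<bar>b - of_int k\<bar> \<in> range (\<lambda>k :: int. \<bar>a - of_int k\<bar>)" by blast
  qed
  then show "(INF k :: int. \<bar>a - of_int k\<bar>) = (INF k :: int. \<bar>b - of_int k\<bar>)" by simp
qed

lift_definition e_circle :: "real_mod_one \<Rightarrow> complex"
  is "\<lambda>y. exp (2 * \<i> * of_real pi * of_real y)"
proof -
  fix a b :: real
  assume ab: "a - b \<in> \<int>"
  have "exp (2 * \<i> * of_real pi * of_real a) = cis (2 * pi * b + 2 * pi * (a - b))"
    by (simp add: cis_conv_exp algebra_simps)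
  also have "\<dots> = cis (2 * pi * b) * cis (2 * pi * (a - b))"
    by (rule cis_mult [symmetric])
  also have "\<dots> = cis (2 * pi * b)"
    using ab by (simp only: cis_multiple_2pi mult_1_right)
  also have "\<dots> = exp (2 * \<i> * of_real pi * of_real b)"
    by (simp add: cis_conv_exp algebra_simps)
  finally show "exp (2 * \<i> * of_real pi * of_real a) = exp (2 * \<i> * of_real pi * of_real b)" .
qed

definition primorial_below :: "real \<Rightarrow> nat" where
  "primorial_below z0 = \<Prod>{p. prime p \<and> real p < z0}"

text \<open>
  For nonempty \<open>X\<close> and \<open>z \<ge> 1\<close> the infimum below is a minimum: the admissible \<open>a/q\<close> take only
  finitely many values modulo 1. It is taken in the extended reals so that the minimum over
  the empty set (the case of empty \<open>X\<close>) is \<open>\<infinity>\<close>, whose inverse is \<open>0\<close>.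
\<close>

definition delta_star :: "real_mod_one set \<Rightarrow> real \<Rightarrow> real \<Rightarrow> ereal" where
  "delta_star X z z0 =
     Inf {ereal (dist_to_zero (\<Sum>A - \<Sum>B - to_mod_one (of_int a / of_nat q))) | A B (a :: int) (q :: nat).
            A \<subseteq> X \<and> B \<subseteq> X \<and> A \<noteq> B \<and> 0 < q \<and> real q \<le> z \<and> coprime q (primorial_below z0)}"

definition l2_norm_sq :: "(nat \<Rightarrow> complex) \<Rightarrow> real" where
  "l2_norm_sq f = (\<Sum>n. (cmod (f n))\<^sup>2)"

definition c_const :: "real_mod_one set \<Rightarrow> nat set \<Rightarrow> real \<Rightarrow> real \<Rightarrow> real \<Rightarrow> real" where
  "c_const X S N z0 \<kappa> =
     9 * (ln (64 * ((N + real_of_ereal (inverse (delta_star X (N powr \<kappa>) z0)))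
                      / (\<kappa> * real (card S) * ln N)) * ln z0)
          / ln (8 * N / (real (card S) * ln N)))"

end

theory Submission
  imports Defs "HOL-Analysis.Analysis"
begin

text \<open>
  By duality it suffices to bound \<open>\<Sum>\<^bsub>p \<in> S\<^esub> |G(p)|\<^sup>2\<close> for \<open>G(p) = \<Sum>\<^bsub>x\<^esub> b\<^sub>x e(px)\<close>.
  The function \<open>exp (Re G)\<close> is dominated by the Riesz product
  \<open>\<Prod>\<^bsub>x\<^esub> (cosh |b\<^sub>x| + sinh |b\<^sub>x| cos(\<dots>))\<close>, which is the square of the modulus of an
  exponential sum whose frequencies are the subset sums of \<open>X\<close>. Multiplying that sum by the Selberg
  kernel \<open>\<Sum>\<^bsub>q\<^esub> (\<mu>(q)/\<phi>(q)) c\<^sub>q(p)\<close>, with \<open>q \<le> N\<^bsup>\<kappa>/2\<^esup>\<close> free of prime factors below \<open>z\<^sub>0\<close>, adds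
  fractions to the frequencies; these stay separated by the assumption on \<open>\<delta>\<^sub>*\<close>, so the dual
  large sieve gives a mean value over primes with the saving \<open>log z\<^sub>0 / (\<kappa> log N)\<close>.
  Exponential moments of \<open>Re G\<close> and \<open>Im G\<close> under the counting measure of \<open>S\<close> then control
  the second moment.
\<close>

section \<open>Chebyshev and Mertens bounds\<close>

text \<open>A large sieve applied directly to the points of \<open>X\<close> uses only their
  pairwise separation and leaves N + 1/\<delta> as a factor of the bound, not the size of S. The
  stronger bound needs all subset sums of \<open>X\<close> to be separated. This acts as a form of
  independence: the Riesz product turns it into a Rudin-type sub-Gaussian estimate, in which N +
  1/\<delta> is a mean-value constant that finally enters only through its logarithm. Two halvings
  make the hypothesis fit exactly. A squared modulus involves differences of two subset sums, the
  quantity that \<open>delta_star\<close> controls. Two fractions with denominators at most N powr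
  (\<kappa>/2) differ by one with denominator at most N powr \<kappa>. The logarithm of 8N/(|S| log
  N) cancels against the denominator of \<open>c_const\<close>, so the estimate to prove has
  constant 9 log(64 L) with L = (N + 1/\<delta>) log z0 / (\<kappa> |S| log N). The 64 and the 9
  only have to absorb numerical losses.\<close>

lemma prod_primes_dvd:
  fixes m :: nat
  assumes "finite A" "\<And>p. p \<in> A \<Longrightarrow> prime p" "\<And>p. p \<in> A \<Longrightarrow> p dvd m"
  shows "\<Prod>A dvd m"
  using assms
proof (induction A rule: finite_induct)
  case (insert p A)
  have "coprime p (\<Prod>A)"
    using insert.prems insert.hyps
    by (intro prod_coprime_right) (metis insertCI primes_coprime)
  then show ?case
    using insert by (simp add: divides_mult)
qed simp

lemma finite_primes_le [simp]: "finite {p::nat. prime p \<and> p \<le> n}"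
  by (rule finite_subset[of _ "{..n}"]) auto

text \<open>Erdos's induction: for n = 2m + 1 the primes in (m + 1, n] all divide the binomial
  coefficient (n choose m), which is at most 4^m because half of the row sum 2^n is already 4^m.
  Even n > 2 are composite and reduce to n - 1.\<close>

lemma primorial_le_pow4: "\<Prod>{p::nat. prime p \<and> p \<le> n} \<le> 4 ^ n"
proof (induction n rule: less_induct)
  case (less n)
  consider "n \<le> 2" | "n > 2" "even n" | m where "n = 2 * m + 1" "m \<ge> 1"
    by (metis One_nat_def Suc_eq_plus1 Suc_leI evenE gr0I linorder_not_less mult_0_right not_less_eq_eq numeral_2_eq_2 oddE zero_le)
  then show ?case
  proof cases
    case 1
    then consider "n < 2" | "n = 2" by linarith
    then show ?thesis
    proof cases
      case 1
      then have *: "{p::nat. prime p \<and> p \<le> n} = {}" by (auto dest: prime_ge_2_nat)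
      show ?thesis unfolding * by simp
    next
      case 2
      have "{p::nat. prime p \<and> p \<le> 2} = {2}"
        by (auto simp: le_antisym prime_ge_2_nat)
      with 2 show ?thesis by simp
    qed
  next
    case 2
    then have "\<not> prime n" using prime_nat_iff by (metis dvd_def even_iff_mod_2_eq_zero less_numeral_extra(4) mod_0_imp_dvd numeral_One numeral_eq_iff semiring_norm(85) less_irrefl)
    then have "{p::nat. prime p \<and> p \<le> n} = {p. prime p \<and> p \<le> n - 1}"
      by (auto simp: le_eq_less_or_eq)
    also have "\<Prod>\<dots> \<le> 4 ^ (n - 1)" using 2 by (intro less) auto
    also have "\<dots> \<le> 4 ^ n" by (intro power_increasing) auto
    finally show ?thesis .
  next
    case (3 m)
    let ?B = "{p::nat. prime p \<and> m + 1 < p \<and> p \<le> n}"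
    have finB: "finite ?B" by (rule finite_subset[of _ "{..n}"]) auto
    have split: "{p::nat. prime p \<and> p \<le> n} = {p. prime p \<and> p \<le> m + 1} \<union> ?B"
      using 3 by auto
    have "\<Prod>?B dvd (2 * m + 1) choose m"
    proof (rule prod_primes_dvd[OF finB])
      fix p assume p: "p \<in> ?B"
      have "fact m * fact (m + 1) * ((2 * m + 1) choose m) = (fact (2 * m + 1) :: nat)"
        using binomial_fact_lemma[of m "2 * m + 1"] by (simp add: mult_ac)
      moreover have "p dvd fact (2 * m + 1)"
        using p 3 by (subst prime_dvd_fact_iff) auto
      moreover have "\<not> p dvd fact m" "\<not> p dvd fact (m + 1)"
        using p by (subst prime_dvd_fact_iff; auto)+
      ultimately show "p dvd (2 * m + 1) choose m"
        using p by (metis (no_types, lifting) mem_Collect_eq prime_dvd_mult_iff)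
    qed auto
    then have "\<Prod>?B \<le> (2 * m + 1) choose m"
      by (rule dvd_imp_le) simp
    also have "\<dots> \<le> 4 ^ m"
    proof -
      have "(2 * m + 1) choose m \<le> (\<Sum>k\<le>m. (2 * m + 1) choose k)"
        by (rule member_le_sum) auto
      also have "\<dots> = 4 ^ m"
        by (subst binomial_r_part_sum) (simp add: power_mult)
      finally show ?thesis .
    qed
    finally have B: "\<Prod>?B \<le> 4 ^ m" .
    have "\<Prod>{p::nat. prime p \<and> p \<le> n} = \<Prod>{p::nat. prime p \<and> p \<le> m + 1} * \<Prod>?B"
      unfolding split by (rule prod.union_disjoint) (use finB in auto)
    also have "\<dots> \<le> 4 ^ (m + 1) * 4 ^ m"
      by (intro mult_mono B less) (use 3 in auto)
    also have "\<dots> = 4 ^ n" using 3 by (simp flip: power_add)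
    finally show ?thesis .
  qed
qed

lemma ln_of_nat_prod:
  assumes "finite A" "\<And>p. p \<in> A \<Longrightarrow> p > 0"
  shows "ln (real (\<Prod>A)) = (\<Sum>p\<in>A. ln (real p))"
proof -
  have "ln (\<Prod>p\<in>A. real p) = (\<Sum>p\<in>A. ln (real p))"
    using assms by (intro ln_prod) auto
  then show ?thesis by simp
qed

lemma sum_ln_primes_le: "(\<Sum>p | prime p \<and> p \<le> n. ln (real p)) \<le> real n * ln 4"
proof -
  have "(\<Sum>p | prime p \<and> p \<le> n. ln (real p)) = ln (real (\<Prod>{p::nat. prime p \<and> p \<le> n}))"
    by (subst ln_of_nat_prod) (simp_all add: prime_gt_0_nat)
  also have "\<dots> \<le> ln (real (4 ^ n))"
    by (intro ln_mono) (use primorial_le_pow4[of n] in \<open>auto simp: prime_gt_0_nat prod_pos simp del: of_nat_power simp flip: of_nat_prod\<close>)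
  finally show ?thesis by (simp add: ln_realpow)
qed

lemma sum_ln_prime_divisors_le:
  assumes "m > 0"
  shows "(\<Sum>p | prime p \<and> p dvd m. ln (real p)) \<le> ln (real m)"
proof -
  have fin: "finite {p. prime p \<and> p dvd m}"
    by (rule finite_subset[of _ "{..m}"]) (use assms in \<open>auto dest: dvd_imp_le\<close>)
  have "(\<Sum>p | prime p \<and> p dvd m. ln (real p)) = ln (real (\<Prod>{p::nat. prime p \<and> p dvd m}))"
    by (subst ln_of_nat_prod) (simp_all add: fin prime_gt_0_nat)
  also have "\<dots> \<le> ln (real m)"
  proof (rule ln_mono)
    have "\<Prod>{p::nat. prime p \<and> p dvd m} \<le> m"
      by (intro dvd_imp_le prod_primes_dvd fin) (use assms in auto)
    then show "real (\<Prod>{p::nat. prime p \<and> p dvd m}) \<le> real m"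
      by (rule of_nat_mono)
    show "0 < real (\<Prod>{p::nat. prime p \<and> p dvd m})"
      unfolding of_nat_0_less_iff by (rule prod_pos) (auto simp: prime_gt_0_nat)
  qed
  finally show ?thesis .
qed

text \<open>Mertens' double count: summing ln p over all pairs p | m with m \<le> n gives at most n
  ln n, since the product of the distinct primes dividing m is at most m. Replacing the integer part
  of n/p by n/p costs the Chebyshev sum, at most n ln 4.\<close>

lemma sum_ln_prime_div_le:
  assumes "n > 0"
  shows "(\<Sum>p | prime p \<and> p \<le> n. ln (real p) / real p) \<le> ln (real n) + ln 4"
proof -
  let ?P = "{p::nat. prime p \<and> p \<le> n}"
  have "real n * (\<Sum>p\<in>?P. ln (real p) / real p) - (\<Sum>p\<in>?P. ln (real p))
      = (\<Sum>p\<in>?P. ln (real p) * (real n / real p - 1))"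
    by (simp add: sum_distrib_left flip: sum_subtractf) (simp add: algebra_simps)
  also have "\<dots> \<le> (\<Sum>p\<in>?P. ln (real p) * real (n div p))"
  proof (intro sum_mono mult_left_mono)
    fix p assume "p \<in> ?P"
    then have p: "p > 0" by (auto simp: prime_gt_0_nat)
    have "real n < real p * (real (n div p) + 1)"
      using dividend_less_div_times[OF p, of n] by (metis add.commute distrib_left mult.commute mult_1_right of_nat_1 of_nat_add of_nat_less_iff of_nat_mult)
    then show "real n / real p - 1 \<le> real (n div p)"
      using p by (simp add: field_simps)
  qed (auto intro!: ln_ge_zero simp: prime_ge_Suc_0_nat)
  also have "\<dots> = (\<Sum>p\<in>?P. \<Sum>m | m \<in> {1..n} \<and> p dvd m. ln (real p))"
  proof (intro sum.cong refl)
    fix p assume "p \<in> ?P"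
    then have p: "p > 0" by (auto simp: prime_gt_0_nat)
    have "bij_betw (\<lambda>k. p * k) {1..n div p} {m \<in> {1..n}. p dvd m}"
      using p by (intro bij_betwI[of _ _ _ "\<lambda>m. m div p"])
        (auto simp: less_eq_div_iff_mult_less_eq mult.commute div_le_mono elim!: dvdE)
    then have "card {m \<in> {1..n}. p dvd m} = n div p"
      using bij_betw_same_card by fastforce
    then show "ln (real p) * real (n div p) = (\<Sum>m | m \<in> {1..n} \<and> p dvd m. ln (real p))"
      by simp
  qed
  also have "\<dots> = (\<Sum>m\<in>{1..n}. \<Sum>p | p \<in> ?P \<and> p dvd m. ln (real p))"
    by (rule sum.swap_restrict) auto
  also have "\<dots> \<le> (\<Sum>m\<in>{1..n}. ln (real n))"
  proof (intro sum_mono)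
    fix m assume m: "m \<in> {1..n}"
    then have "{p. p \<in> ?P \<and> p dvd m} = {p. prime p \<and> p dvd m}"
      by (auto dest: dvd_imp_le)
    then have "(\<Sum>p | p \<in> ?P \<and> p dvd m. ln (real p)) \<le> ln (real m)"
      using sum_ln_prime_divisors_le[of m] m by simp
    also have "\<dots> \<le> ln (real n)" using m by simp
    finally show "(\<Sum>p | p \<in> ?P \<and> p dvd m. ln (real p)) \<le> ln (real n)" .
  qed
  finally have "real n * (\<Sum>p\<in>?P. ln (real p) / real p) \<le> real n * ln (real n) + real n * ln 4"
    using sum_ln_primes_le[of n] by simp
  then have "real n * (\<Sum>p\<in>?P. ln (real p) / real p) \<le> real n * (ln (real n) + ln 4)"
    by (simp add: algebra_simps)
  then show ?thesis using assms by simp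
qed

lemma sum_ln_prime_div_pred_le:
  assumes "n > 0"
  shows "(\<Sum>p | prime p \<and> p \<le> n. ln (real p) / (real p - 1)) \<le> 2 * ln (real n) + 2 * ln 4"
proof -
  have "(\<Sum>p | prime p \<and> p \<le> n. ln (real p) / (real p - 1)) \<le> (\<Sum>p | prime p \<and> p \<le> n. 2 * (ln (real p) / real p))"
  proof (rule sum_mono)
    fix p assume "p \<in> {p. prime p \<and> p \<le> n}"
    then have p: "p \<ge> 2" using prime_ge_2_nat by auto
    have "ln (real p) / (real p - 1) \<le> ln (real p) / (real p / 2)"
      using p by (intro divide_left_mono) auto
    then show "ln (real p) / (real p - 1) \<le> 2 * (ln (real p) / real p)" by (simp add: divide_simps)
  qed
  then show ?thesis
    using sum_ln_prime_div_le[OF assms] by (simp only: sum_distrib_left[symmetric])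
qed

text \<open>Comparison with the integral of x powr (-(1 + \<eta>)), done by telescoping: each new
  term is at most the decrease of x powr (-\<eta>) / \<eta> over one step, by ln(1 + 1/x) \<ge> 1/(x
  + 1) and exp u \<ge> 1 + u.\<close>

lemma sum_powr_le:
  fixes \<eta> :: real
  assumes "\<eta> > 0"
  shows "(\<Sum>n=1..Suc M. real n powr (- (1 + \<eta>))) \<le> 1 + (1 - real (Suc M) powr (- \<eta>)) / \<eta>"
proof (induction M)
  case (Suc M)
  define x where "x = real (Suc M)"
  have x: "x \<ge> 1" by (simp add: x_def)
  have "1 / (x + 1) \<le> ln (1 + 1 / x)"
  proof -
    have "- ln (1 + 1 / x) = ln (x / (x + 1))"
      using x by (subst ln_inverse[symmetric]) (auto simp: field_simps)
    also have "\<dots> \<le> x / (x + 1) - 1" using x by (intro ln_le_minus_one) auto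
    also have "\<dots> = - (1 / (x + 1))" using x by (simp add: field_simps)
    finally show ?thesis by simp
  qed
  then have "1 + \<eta> / (x + 1) \<le> 1 + \<eta> * ln (1 + 1 / x)"
    using assms mult_left_mono[of "1 / (x + 1)" "ln (1 + 1 / x)" \<eta>] by simp
  also have "\<dots> \<le> exp (\<eta> * ln (1 + 1 / x))" by (rule exp_ge_add_one_self)
  also have "\<dots> = (1 + 1 / x) powr \<eta>" using x by (simp add: powr_def add_nonneg_eq_0_iff)
  also have "1 + 1 / x = (x + 1) / x" using x by (simp add: field_simps)
  also have "((x + 1) / x) powr \<eta> = (x + 1) powr \<eta> / x powr \<eta>"
    by (rule powr_divide)
  finally have "(x + 1) powr (- \<eta>) * (1 + \<eta> / (x + 1)) \<le> (x + 1) powr (- \<eta>) * ((x + 1) powr \<eta> / x powr \<eta>)"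
    by (rule mult_left_mono) simp
  also have "\<dots> = x powr (- \<eta>)"
    using x by (simp add: powr_minus field_simps)
  finally have *: "\<eta> * ((x + 1) powr (- \<eta>) / (x + 1)) \<le> x powr (- \<eta>) - (x + 1) powr (- \<eta>)"
    by (simp add: algebra_simps)
  have "(x + 1) powr (- (1 + \<eta>)) = (x + 1) powr (- \<eta>) / (x + 1)"
    using x by (simp add: powr_diff powr_minus_divide mult.commute)
  then have "(x + 1) powr (- (1 + \<eta>)) \<le> (x powr (- \<eta>) - (x + 1) powr (- \<eta>)) / \<eta>"
    using * assms by (simp add: field_simps)
  then show ?case
    using Suc.IH by (simp add: x_def diff_divide_distrib add.commute[of 1])
qed simp

section \<open>Removing finitely many Euler factors from the zeta function\<close>

definition coprime_to_all :: "nat set \<Rightarrow> nat set" where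
  "coprime_to_all D = {n. n > 0 \<and> (\<forall>p\<in>D. \<not> p dvd n)}"

text \<open>This is \<zeta>(1 + \<eta>) without its Euler factors at \<open>D\<close>. Removing
  factors one prime at a time keeps every product finite.\<close>

definition coprime_zeta :: "nat set \<Rightarrow> real \<Rightarrow> real" where
  "coprime_zeta D \<eta> = (\<Sum>\<^sub>\<infinity>n\<in>coprime_to_all D. real n powr (- (1 + \<eta>)))"

text \<open>The multiples of p among these integers are p times the same set, because p lies outside
  \<open>D\<close>. This partition produces one Euler factor, and later its truncated
  analogue.\<close>

lemma coprime_to_all_insert:
  assumes "prime p" "p \<notin> D" "\<And>q. q \<in> D \<Longrightarrow> prime q"
  shows "coprime_to_all D = coprime_to_all (insert p D) \<union> (*) p ` coprime_to_all D"
    and "coprime_to_all (insert p D) \<inter> (*) p ` coprime_to_all D = {}"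
proof -
  have p: "p > 0" using assms(1) by (simp add: prime_gt_0_nat)
  have *: "\<not> q dvd p" if "q \<in> D" for q
    using assms that primes_dvd_imp_eq by blast
  show "coprime_to_all D = coprime_to_all (insert p D) \<union> (*) p ` coprime_to_all D"
  proof (intro equalityI subsetI)
    fix n assume n: "n \<in> coprime_to_all D"
    show "n \<in> coprime_to_all (insert p D) \<union> (*) p ` coprime_to_all D"
    proof (cases "p dvd n")
      case True
      then obtain k where "n = p * k" by (elim dvdE)
      moreover from this have "k \<in> coprime_to_all D"
        using n by (auto simp: coprime_to_all_def)
      ultimately show ?thesis by blast
    next
      case False
      then show ?thesis using n by (auto simp: coprime_to_all_def)
    qed
  next
    fix n assume "n \<in> coprime_to_all (insert p D) \<union> (*) p ` coprime_to_all D"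
    then show "n \<in> coprime_to_all D"
      using p * assms(3) by (auto simp: coprime_to_all_def prime_dvd_mult_iff)
  qed
  show "coprime_to_all (insert p D) \<inter> (*) p ` coprime_to_all D = {}"
    by (auto simp: coprime_to_all_def)
qed

lemma summable_on_powr:
  assumes "\<eta> > 0"
  shows "(\<lambda>n::nat. real n powr (- (1 + \<eta>))) summable_on A"
proof -
  have "(\<lambda>n::nat. real n powr (- (1 + \<eta>))) summable_on UNIV"
    using assms by (intro norm_summable_imp_summable_on) (simp add: summable_real_powr_iff)
  then show ?thesis by (rule summable_on_subset_banach) auto
qed

lemma coprime_zeta_insert:
  assumes "\<eta> > 0" "prime p" "p \<notin> D" "\<And>q. q \<in> D \<Longrightarrow> prime q"
  shows "coprime_zeta (insert p D) \<eta> = (1 - real p powr (- (1 + \<eta>))) * coprime_zeta D \<eta>"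
proof -
  let ?f = "\<lambda>n::nat. real n powr (- (1 + \<eta>))"
  have p: "p > 0" using assms by (simp add: prime_gt_0_nat)
  have "coprime_zeta D \<eta> = infsum ?f (coprime_to_all (insert p D) \<union> (*) p ` coprime_to_all D)"
    unfolding coprime_zeta_def using coprime_to_all_insert(1)[OF assms(2-4)] by simp
  also have "\<dots> = infsum ?f (coprime_to_all (insert p D)) + infsum ?f ((*) p ` coprime_to_all D)"
    by (intro infsum_Un_disjoint summable_on_powr assms coprime_to_all_insert)
  also have "infsum ?f ((*) p ` coprime_to_all D) = infsum (?f \<circ> (*) p) (coprime_to_all D)"
    by (rule infsum_reindex) (use p in \<open>auto simp: inj_on_def\<close>)
  also have "\<dots> = real p powr (- (1 + \<eta>)) * coprime_zeta D \<eta>"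
    unfolding coprime_zeta_def by (simp add: o_def powr_mult infsum_cmult_right')
  finally show ?thesis by (simp add: coprime_zeta_def algebra_simps)
qed

lemma coprime_zeta_eq:
  assumes "\<eta> > 0" "finite D" "\<And>q. q \<in> D \<Longrightarrow> prime q"
  shows "coprime_zeta D \<eta> = (\<Prod>p\<in>D. 1 - real p powr (- (1 + \<eta>))) * coprime_zeta {} \<eta>"
  using assms(2,3)
proof (induction D rule: finite_induct)
  case (insert p D)
  then show ?case
    using coprime_zeta_insert[OF assms(1), of p D] by simp
qed simp

text \<open>The term n = 1 survives the removal of any primes. Together with
  \<open>coprime_zeta_eq\<close> this bounds the product over \<open>D\<close> from below by
  1/\<zeta>(1 + \<eta>).\<close>

lemma coprime_zeta_ge_1:
  assumes "\<eta> > 0" "\<And>q. q \<in> D \<Longrightarrow> prime q"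
  shows "coprime_zeta D \<eta> \<ge> 1"
proof -
  have "infsum (\<lambda>n::nat. real n powr (- (1 + \<eta>))) {1} \<le> coprime_zeta D \<eta>"
    unfolding coprime_zeta_def
    by (intro infsum_mono_neutral summable_on_powr assms)
      (use assms(2) not_prime_unit in \<open>auto simp: coprime_to_all_def\<close>)
  then show ?thesis by simp
qed

lemma coprime_zeta_empty_le:
  assumes "\<eta> > 0"
  shows "coprime_zeta {} \<eta> \<le> 1 + 1 / \<eta>"
  unfolding coprime_zeta_def
proof (rule infsum_le_finite_sums)
  fix F :: "nat set"
  assume F: "finite F" "F \<subseteq> coprime_to_all {}"
  then obtain M where M: "F \<subseteq> {..M}" using finite_nat_iff_bounded_le by blast
  have "(\<Sum>n\<in>F. real n powr (- (1 + \<eta>))) \<le> (\<Sum>n=1..Suc M. real n powr (- (1 + \<eta>)))"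
  proof (rule sum_mono2)
    show "F \<subseteq> {1..Suc M}"
    proof
      fix n assume "n \<in> F"
      then have "n \<in> coprime_to_all {}" "n \<in> {..M}" using F M by blast+
      then show "n \<in> {1..Suc M}" by (simp add: coprime_to_all_def)
    qed
  qed auto
  also have "\<dots> \<le> 1 + (1 - real (Suc M) powr (- \<eta>)) / \<eta>" by (rule sum_powr_le[OF assms])
  also have "\<dots> \<le> 1 + 1 / \<eta>" using assms by (simp add: field_simps)
  finally show "(\<Sum>n\<in>F. real n powr (- (1 + \<eta>))) \<le> 1 + 1 / \<eta>" .
qed (rule summable_on_powr[OF assms])

text \<open>Rankin's trick: \<open>\<eta>\<close> will be of order \<open>1 / log x\<close>, so that the exponential stays bounded
  and the product over the primes below \<open>x\<close> is compared with \<open>\<zeta>(1 + \<eta>) \<le> 1 + 1/\<eta>\<close>.\<close>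

lemma one_le_zeta_times_prod:
  assumes "\<eta> > 0" "finite D" "\<And>q. q \<in> D \<Longrightarrow> prime q"
  shows "1 \<le> (1 + 1 / \<eta>) * exp (\<eta> * (\<Sum>p\<in>D. ln (real p) / (real p - 1))) * (\<Prod>p\<in>D. 1 - 1 / real p)"
proof -
  have "1 \<le> (\<Prod>p\<in>D. 1 - real p powr (- (1 + \<eta>))) * coprime_zeta {} \<eta>"
    using coprime_zeta_ge_1[of \<eta> D] coprime_zeta_eq[of \<eta> D] assms by metis
  also have "\<dots> \<le> (\<Prod>p\<in>D. exp (\<eta> * (ln (real p) / (real p - 1))) * (1 - 1 / real p)) * (1 + 1 / \<eta>)"
  proof (intro mult_mono prod_mono conjI coprime_zeta_empty_le assms(1) prod_nonneg)
    fix p assume "p \<in> D"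
    then have p: "real p \<ge> 2" using assms(3) prime_ge_2_nat by fastforce
    have "1 + - (\<eta> * ln (real p)) \<le> exp (- (\<eta> * ln (real p)))"
      by (rule exp_ge_add_one_self)
    also have "\<dots> = real p powr (- \<eta>)" using p by (simp add: powr_def)
    finally have "(1 / real p) * (1 - \<eta> * ln (real p)) \<le> (1 / real p) * real p powr (- \<eta>)"
      by (intro mult_left_mono) auto
    also have "\<dots> = real p powr (- (1 + \<eta>))"
      using p by (simp add: powr_diff powr_minus_divide)
    finally have "1 - real p powr (- (1 + \<eta>)) \<le> 1 - (1 / real p) * (1 - \<eta> * ln (real p))" by simp
    \<comment> \<open>The denominator p - 1, instead of p, is what makes this factorisation exact;
      it is the origin of the sums with p - 1.\<close>
    also have "\<dots> = (1 + \<eta> * (ln (real p) / (real p - 1))) * (1 - 1 / real p)"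
      using p by (simp add: field_simps)
    also have "\<dots> \<le> exp (\<eta> * (ln (real p) / (real p - 1))) * (1 - 1 / real p)"
      using p by (intro mult_right_mono exp_ge_add_one_self) auto
    finally show "1 - real p powr (- (1 + \<eta>)) \<le> exp (\<eta> * (ln (real p) / (real p - 1))) * (1 - 1 / real p)" .
    have "real p powr (- (1 + \<eta>)) \<le> real p powr 0"
      using p assms by (intro powr_mono) auto
    then show "0 \<le> 1 - real p powr (- (1 + \<eta>))" using p by simp
    show "0 \<le> exp (\<eta> * (ln (real p) / (real p - 1))) * (1 - 1 / real p)" using p by simp
  next
    show "0 \<le> coprime_zeta {} \<eta>" using coprime_zeta_ge_1[OF assms(1), of "{}"] by simp
  qed
  finally show ?thesis using assms(2)
    by (simp add: prod.distrib exp_sum sum_distrib_left mult_ac)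
qed

section \<open>Sums over integers without small prime factors\<close>

definition coprime_harm :: "nat set \<Rightarrow> nat \<Rightarrow> real" where
  "coprime_harm D K = (\<Sum>n | n \<in> coprime_to_all D \<and> n \<le> K. 1 / real n)"

lemma finite_coprime_to_all_le [simp]: "finite {n. n \<in> coprime_to_all D \<and> n \<le> K}"
  by (rule finite_subset[of _ "{..K}"]) auto

text \<open>Same partition as for the zeta sum, but a multiple n \<le> K of p has cofactor at most
  K/p. Letting the cofactor range up to K only enlarges the subtracted part, so an inequality in the
  useful direction remains.\<close>

lemma coprime_harm_insert:
  assumes "prime p" "p \<notin> D" "\<And>q. q \<in> D \<Longrightarrow> prime q"
  shows "(1 - 1 / real p) * coprime_harm D K \<le> coprime_harm (insert p D) K"
proof -
  let ?C = "\<lambda>D. {n. n \<in> coprime_to_all D \<and> n \<le> K}"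
  have p: "p > 0" using assms by (simp add: prime_gt_0_nat)
  have "coprime_harm D K \<le> (\<Sum>n\<in>?C (insert p D) \<union> (*) p ` ?C D. 1 / real n)"
    unfolding coprime_harm_def
  proof (rule sum_mono2)
    show "?C D \<subseteq> ?C (insert p D) \<union> (*) p ` ?C D"
    proof
      fix n assume n: "n \<in> ?C D"
      then consider "n \<in> coprime_to_all (insert p D)" | k where "n = p * k" "k \<in> coprime_to_all D"
        using coprime_to_all_insert(1)[OF assms] by blast
      then show "n \<in> ?C (insert p D) \<union> (*) p ` ?C D"
      proof cases
        case 2
        then have "k \<le> n" using p by simp
        then have "k \<le> K" using n by (auto intro: order_trans)
        with 2 have "k \<in> ?C D" by simp
        with 2 show ?thesis by blast
      qed (use n in auto)
    qed
  qed auto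
  also have "\<dots> \<le> coprime_harm (insert p D) K + (\<Sum>n\<in>(*) p ` ?C D. 1 / real n)"
    unfolding coprime_harm_def by (subst sum_Un) (auto intro!: sum_nonneg)
  also have "(\<Sum>n\<in>(*) p ` ?C D. 1 / real n) = (1 / real p) * coprime_harm D K"
    unfolding coprime_harm_def using p
    by (subst sum.reindex) (auto simp: inj_on_def sum_distrib_left)
  finally show ?thesis by (simp add: algebra_simps)
qed

lemma coprime_harm_ge:
  assumes "finite D" "\<And>q. q \<in> D \<Longrightarrow> prime q"
  shows "(\<Prod>p\<in>D. 1 - 1 / real p) * coprime_harm {} K \<le> coprime_harm D K"
  using assms
proof (induction D rule: finite_induct)
  case (insert p D)
  have "real p \<ge> 1" using insert.prems[of p] prime_ge_1_nat by simp
  then have "(1 - 1 / real p) * ((\<Prod>p\<in>D. 1 - 1 / real p) * coprime_harm {} K) \<le> (1 - 1 / real p) * coprime_harm D K"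
    using insert by (intro mult_left_mono) auto
  also have "\<dots> \<le> coprime_harm (insert p D) K"
    using insert by (intro coprime_harm_insert) auto
  finally show ?case using insert by (simp add: mult.assoc)
qed simp

lemma ln_le_coprime_harm_empty: "ln (real K + 1) \<le> coprime_harm {} K"
proof -
  have "{n. n \<in> coprime_to_all {} \<and> n \<le> K} = {1..K}"
    by (auto simp: coprime_to_all_def)
  then show ?thesis
    using ln_le_harm[of K] by (simp add: coprime_harm_def harm_def inverse_eq_divide)
qed

text \<open>Unique factorisation turns the sum into part of a product of geometric series 1/p +
  1/p^2 + ... = 1/(p - 1), one for each prime of \<open>D\<close>. The product on the right is
  1/\<phi>(q) for the radical q.\<close>

lemma sum_inverse_same_prime_factors_le:
  assumes "finite C" "finite D" "\<And>p. p \<in> D \<Longrightarrow> prime p"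
    "\<And>n. n \<in> C \<Longrightarrow> n > 0 \<and> prime_factors n = D"
  shows "(\<Sum>n\<in>C. 1 / real n) \<le> (\<Prod>p\<in>D. 1 / (real p - 1))"
proof -
  \<comment> \<open>Exponents are smaller than 2 to their own power, hence than n, so E bounds them
    too and all series can be truncated at E.\<close>
  obtain E where E: "C \<subseteq> {..E}" using assms(1) finite_nat_iff_bounded_le by blast
  define \<phi> where "\<phi> = (\<lambda>n. \<lambda>p\<in>D. multiplicity p n)"
  have n_eq: "n = (\<Prod>p\<in>D. p ^ \<phi> n p)" if "n \<in> C" for n
    using prime_factorization_nat[of n] assms(4)[OF that] by (simp add: \<phi>_def)
  have inj: "inj_on \<phi> C"
    by (rule inj_onI) (metis n_eq)
  have \<phi>: "\<phi> ` C \<subseteq> (\<Pi>\<^sub>E p\<in>D. {1..E})"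
  proof (intro image_subsetI PiE_I)
    fix n p assume n: "n \<in> C" and p: "p \<in> D"
    have pp: "prime p" using p assms by blast
    have "multiplicity p n \<noteq> 0" using assms(4)[OF n] p
      by (auto simp: prime_factors_multiplicity)
    moreover have "multiplicity p n \<le> E"
    proof -
      have "multiplicity p n < 2 ^ multiplicity p n" by (rule less_exp)
      also have "\<dots> \<le> p ^ multiplicity p n"
        using prime_ge_2_nat[OF pp] by (intro power_mono) auto
      also have "\<dots> \<le> n" using assms(4)[OF n] by (intro dvd_imp_le multiplicity_dvd) auto
      also have "\<dots> \<le> E" using n E by auto
      finally show ?thesis by simp
    qed
    ultimately show "\<phi> n p \<in> {1..E}" using p by (auto simp: \<phi>_def)
  qed (auto simp: \<phi>_def)
  have "(\<Sum>n\<in>C. 1 / real n) = (\<Sum>n\<in>C. \<Prod>p\<in>D. (1 / real p) ^ \<phi> n p)"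
  proof (intro sum.cong refl)
    fix n assume "n \<in> C"
    from n_eq[OF this] have "real n = (\<Prod>p\<in>D. real p ^ \<phi> n p)"
      by (metis (mono_tags, lifting) of_nat_power of_nat_prod prod.cong)
    then show "1 / real n = (\<Prod>p\<in>D. (1 / real p) ^ \<phi> n p)"
      by (simp add: power_one_over prod_dividef)
  qed
  also have "\<dots> = (\<Sum>e\<in>\<phi> ` C. \<Prod>p\<in>D. (1 / real p) ^ e p)"
    by (simp add: sum.reindex[OF inj] o_def)
  also have "\<dots> \<le> (\<Sum>e\<in>(\<Pi>\<^sub>E p\<in>D. {1..E}). \<Prod>p\<in>D. (1 / real p) ^ e p)"
    by (intro sum_mono2 \<phi> finite_PiE assms(2) prod_nonneg) auto
  also have "\<dots> = (\<Prod>p\<in>D. \<Sum>e\<in>{1..E}. (1 / real p) ^ e)"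
    by (rule prod_sum_PiE[symmetric]) (use assms in auto)
  also have "\<dots> \<le> (\<Prod>p\<in>D. 1 / (real p - 1))"
  proof (intro prod_mono conjI sum_nonneg)
    fix p assume "p \<in> D"
    then have p: "real p \<ge> 2" using assms(3) prime_ge_2_nat by fastforce
    have "(\<Sum>e\<in>{1..E}. (1 / real p) ^ e) = (1 / real p) * (\<Sum>e<E. (1 / real p) ^ e)"
      by (simp add: sum_distrib_left sum.atLeast1_atMost_eq flip: power_Suc)
    also have "\<dots> = (1 / real p) * ((1 - (1 / real p) ^ E) / (1 - 1 / real p))"
      using p by (subst sum_gp_strict) auto
    also have "\<dots> \<le> (1 / real p) * (1 / (1 - 1 / real p))"
      using p by (intro mult_left_mono divide_right_mono) auto
    also have "\<dots> = 1 / (real p - 1)" using p by (simp add: field_simps)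
    finally show "(\<Sum>e\<in>{1..E}. (1 / real p) ^ e) \<le> 1 / (real p - 1)" .
  qed auto
  finally show ?thesis .
qed

text \<open>A squarefree \<open>q \<le> Q\<close> coprime to \<open>P(z\<^sub>0)\<close> is represented by its set \<open>D\<close> of prime factors; then
  \<open>sieve_mass\<close> is the sum of \<open>\<mu>\<^sup>2(q)/\<phi>(q)\<close>.\<close>

definition sieve_supports :: "real \<Rightarrow> real \<Rightarrow> nat set set" where
  "sieve_supports z0 Q = {D. finite D \<and> (\<forall>p\<in>D. prime p \<and> z0 \<le> real p) \<and> real (\<Prod>D) \<le> Q}"

definition sieve_mass :: "real \<Rightarrow> real \<Rightarrow> real" where
  "sieve_mass z0 Q = (\<Sum>D\<in>sieve_supports z0 Q. \<Prod>p\<in>D. 1 / (real p - 1))"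

lemma sieve_supports_le:
  assumes "D \<in> sieve_supports z0 Q" "p \<in> D"
  shows "real p \<le> Q"
proof -
  have "p dvd \<Prod>D" using assms by (auto simp: sieve_supports_def intro: dvd_prodI)
  moreover have "\<Prod>D > 0" using assms by (auto simp: sieve_supports_def prime_gt_0_nat intro!: prod_pos)
  ultimately have "p \<le> \<Prod>D" by (rule dvd_imp_le)
  then have "real p \<le> real (\<Prod>D)" by (rule of_nat_mono)
  then show ?thesis using assms by (simp add: sieve_supports_def)
qed

lemma finite_sieve_supports [simp]: "finite (sieve_supports z0 Q)"
proof (rule finite_subset)
  show "sieve_supports z0 Q \<subseteq> Pow {..nat \<lfloor>Q\<rfloor>}"
    using sieve_supports_le by (auto simp: le_nat_floor)
qed simp

text \<open>Grouping the integers by their radical: the radical of n \<le> Q is again at most Q, and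
  each group contributes at most 1/\<phi> of the radical.\<close>

lemma coprime_harm_le_sieve_mass:
  assumes "Q \<ge> 1"
  shows "coprime_harm {p. prime p \<and> real p < z0} (nat \<lfloor>Q\<rfloor>) \<le> sieve_mass z0 Q"
proof -
  define C where "C = {n. n \<in> coprime_to_all {p. prime p \<and> real p < z0} \<and> n \<le> nat \<lfloor>Q\<rfloor>}"
  have "prime_factors n \<in> sieve_supports z0 Q" if "n \<in> C" for n
  proof -
    have n: "n > 0" "real n \<le> Q" and cop: "\<And>p. prime p \<Longrightarrow> real p < z0 \<Longrightarrow> \<not> p dvd n"
      using that assms by (auto simp: C_def coprime_to_all_def le_nat_iff le_floor_iff)
    have "\<Prod>(prime_factors n) dvd n"
    proof -
      have "\<Prod>(prime_factors n) dvd (\<Prod>p\<in>prime_factors n. p ^ multiplicity p n)"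
        by (intro prod_dvd_prod) (auto simp: prime_factors_multiplicity dvd_power)
      also have "\<dots> = n" using prime_factorization_nat[of n] n by simp
      finally show ?thesis .
    qed
    then have "\<Prod>(prime_factors n) \<le> n" using n by (intro dvd_imp_le)
    then have "real (\<Prod>(prime_factors n)) \<le> Q" using n(2) by (meson of_nat_mono order_trans)
    then show ?thesis using cop
      by (auto simp: sieve_supports_def in_prime_factors_iff not_less[symmetric] simp del: of_nat_prod)
  qed
  then have "coprime_harm {p. prime p \<and> real p < z0} (nat \<lfloor>Q\<rfloor>)
      = (\<Sum>D\<in>sieve_supports z0 Q. \<Sum>n | n \<in> C \<and> prime_factors n = D. 1 / real n)"
    unfolding coprime_harm_def C_def[symmetric]
    by (intro sum.group[symmetric]) (auto simp: C_def)
  also have "\<dots> \<le> sieve_mass z0 Q"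
    unfolding sieve_mass_def
    by (intro sum_mono sum_inverse_same_prime_factors_le)
      (auto simp: C_def sieve_supports_def coprime_to_all_def)
  finally show ?thesis .
qed

lemma finite_primes_less [simp]: "finite {p::nat. prime p \<and> real p < x}"
proof (rule finite_subset)
  show "{p::nat. prime p \<and> real p < x} \<subseteq> {..nat \<lfloor>x\<rfloor>}" by (auto simp: le_nat_floor)
qed simp

lemma one_le_ln_times_prod_primes:
  assumes "x \<ge> 2"
  shows "1 \<le> 22 * ln x * (\<Prod>p | prime p \<and> real p < x. 1 - 1 / real p)"
proof -
  let ?D = "{p::nat. prime p \<and> real p < x}"
  \<comment> \<open>The reciprocal of the bound for the prime sum, so that the exponential in
    Rankin's estimate is at most e.\<close>
  define \<eta> where "\<eta> = 1 / (2 * ln x + 2 * ln 4)"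
  have ln2: "ln 2 \<le> ln x" "2 / 3 \<le> ln (2::real)" using assms ln2_ge_two_thirds by auto
  have ln4: "ln 4 = 2 * ln (2::real)" using ln_realpow[of 2 2] by simp
  have \<eta>: "\<eta> > 0" using ln2 ln4 by (simp add: \<eta>_def)
  have P: "(\<Prod>p\<in>?D. 1 - 1 / real p) \<ge> 0"
    by (intro prod_nonneg) (auto dest: prime_gt_0_nat)
  have "(\<Sum>p\<in>?D. ln (real p) / (real p - 1)) \<le> (\<Sum>p | prime p \<and> p \<le> nat \<lfloor>x\<rfloor>. ln (real p) / (real p - 1))"
  proof (intro sum_mono2)
    fix p :: nat
    assume "p \<in> {p. prime p \<and> p \<le> nat \<lfloor>x\<rfloor>} - ?D"
    then have "p \<ge> 1" by (auto dest: prime_ge_1_nat)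
    then show "0 \<le> ln (real p) / (real p - 1)" by simp
  qed (auto simp: le_nat_floor)
  also have "\<dots> \<le> 2 * ln (real (nat \<lfloor>x\<rfloor>)) + 2 * ln 4"
    using assms by (intro sum_ln_prime_div_pred_le) (simp add: le_nat_iff le_floor_iff)
  also have "\<dots> \<le> 2 * ln x + 2 * ln 4"
    using assms by (auto intro!: ln_mono)
  finally have "\<eta> * (\<Sum>p\<in>?D. ln (real p) / (real p - 1)) \<le> \<eta> * (2 * ln x + 2 * ln 4)"
    using \<eta> by (intro mult_left_mono) auto
  also have "\<dots> = 1" using ln2 ln4 by (simp add: \<eta>_def)
  finally have E: "exp (\<eta> * (\<Sum>p\<in>?D. ln (real p) / (real p - 1))) \<le> exp 1" by simp
  have "1 \<le> (1 + 1 / \<eta>) * exp (\<eta> * (\<Sum>p\<in>?D. ln (real p) / (real p - 1))) * (\<Prod>p\<in>?D. 1 - 1 / real p)"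
    using \<eta> by (intro one_le_zeta_times_prod) auto
  also have "\<dots> \<le> (1 + 1 / \<eta>) * exp 1 * (\<Prod>p\<in>?D. 1 - 1 / real p)"
    using \<eta> E P by (intro mult_right_mono mult_left_mono) auto
  also have "\<dots> \<le> 22 * ln x * (\<Prod>p\<in>?D. 1 - 1 / real p)"
  proof (intro mult_right_mono P)
    \<comment> \<open>Here 1/\<eta> = 2 ln x + 4 ln 2 \<le> 6 ln x, and 1 \<le> 1.5 ln 2 \<le> 1.5
      ln x. Then 7.5 * 2.72 = 20.4 explains the constant 22.\<close>
    have "1 + 1 / \<eta> \<le> 7.5 * ln x" using ln2 ln4 by (simp add: \<eta>_def)
    then have "(1 + 1 / \<eta>) * exp 1 \<le> (7.5 * ln x) * 2.72"
      using \<eta> e_less_272 ln2 by (intro mult_mono) auto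
    also have "\<dots> \<le> 22 * ln x" using ln2 by simp
    finally show "(1 + 1 / \<eta>) * exp 1 \<le> 22 * ln x" .
  qed
  finally show ?thesis .
qed

text \<open>Sifting out the primes below z0 shrinks the harmonic sum up to Q, of size at least ln Q,
  by at most the Mertens factor 22 ln z0.\<close>

lemma ln_le_sieve_mass:
  assumes "z0 \<ge> 2" "Q \<ge> 1"
  shows "ln Q \<le> 22 * ln z0 * sieve_mass z0 Q"
proof -
  let ?D = "{p::nat. prime p \<and> real p < z0}"
  define P where "P = (\<Prod>p\<in>?D. 1 - 1 / real p)"
  have P: "P \<ge> 0"
    unfolding P_def by (intro prod_nonneg) (auto dest: prime_gt_0_nat)
  have "ln Q \<le> ln (real (nat \<lfloor>Q\<rfloor>) + 1)"
    using assms by (intro ln_mono) linarith+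
  also have "\<dots> \<le> coprime_harm {} (nat \<lfloor>Q\<rfloor>)" by (rule ln_le_coprime_harm_empty)
  finally have H: "ln Q \<le> coprime_harm {} (nat \<lfloor>Q\<rfloor>)" .
  have "ln Q \<le> (22 * ln z0 * P) * ln Q"
    using one_le_ln_times_prod_primes[OF assms(1)] assms(2)
      mult_right_mono[of 1 "22 * ln z0 * P" "ln Q"] by (simp add: P_def)
  also have "\<dots> \<le> (22 * ln z0 * P) * coprime_harm {} (nat \<lfloor>Q\<rfloor>)"
    using assms P by (intro mult_left_mono H) auto
  also have "\<dots> = 22 * ln z0 * (P * coprime_harm {} (nat \<lfloor>Q\<rfloor>))" by simp
  also have "\<dots> \<le> 22 * ln z0 * sieve_mass z0 Q"
  proof (intro mult_left_mono)
    have "P * coprime_harm {} (nat \<lfloor>Q\<rfloor>) \<le> coprime_harm ?D (nat \<lfloor>Q\<rfloor>)"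
      unfolding P_def by (rule coprime_harm_ge) auto
    also have "\<dots> \<le> sieve_mass z0 Q" by (rule coprime_harm_le_sieve_mass[OF assms(2)])
    finally show "P * coprime_harm {} (nat \<lfloor>Q\<rfloor>) \<le> sieve_mass z0 Q" .
  qed (use assms in auto)
  finally show ?thesis .
qed

section \<open>Chebyshev bounds for sets of primes\<close>

lemma card_primes_times_ln_le:
  assumes "N \<ge> 0" "y \<ge> 1" "S \<subseteq> {p. prime p \<and> y \<le> real p \<and> real p \<le> N}"
  shows "real (card S) * ln y \<le> N * ln 4"
proof -
  have sub: "S \<subseteq> {p. prime p \<and> p \<le> nat \<lfloor>N\<rfloor>}"
    using assms(3) by (auto simp: le_nat_floor)
  have "real (card S) * ln y = (\<Sum>p\<in>S. ln y)" by simp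
  also have "\<dots> \<le> (\<Sum>p\<in>S. ln (real p))"
    using assms by (intro sum_mono ln_mono) auto
  also have "\<dots> \<le> (\<Sum>p | prime p \<and> p \<le> nat \<lfloor>N\<rfloor>. ln (real p))"
    by (intro sum_mono2 sub) (auto dest: prime_ge_1_nat)
  also have "\<dots> \<le> real (nat \<lfloor>N\<rfloor>) * ln 4" by (rule sum_ln_primes_le)
  also have "\<dots> \<le> N * ln 4" using assms(1) by (intro mult_right_mono) auto
  finally show ?thesis .
qed

text \<open>Split at sqrt N: there are at most sqrt N small elements, and for the others ln p is at
  least half of ln N. The strict inequality makes the logarithm in the denominator of
  \<open>c_const\<close> positive.\<close>

lemma card_primes_times_ln_less:
  assumes "N \<ge> 2" "S \<subseteq> {p. prime p \<and> real p \<le> N}"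
  shows "real (card S) * ln N < 8 * N"
proof -
  have s: "sqrt N \<ge> 1" "sqrt N > 0" using assms by auto
  have fin: "finite S"
    by (rule finite_subset[of _ "{..nat \<lfloor>N\<rfloor>}"]) (use assms in \<open>auto simp: le_nat_floor\<close>)
  define A where "A = {p\<in>S. real p < sqrt N}"
  define B where "B = {p\<in>S. sqrt N \<le> real p}"
  have S: "S = A \<union> B" "A \<inter> B = {}" by (auto simp: A_def B_def)
  have "A \<subseteq> {1..nat \<lfloor>sqrt N\<rfloor>}"
    using assms by (auto simp: A_def le_nat_floor dest!: prime_ge_1_nat)
  then have "card A \<le> nat \<lfloor>sqrt N\<rfloor>"
    using card_mono[of "{1..nat \<lfloor>sqrt N\<rfloor>}" A] by simp
  then have A: "real (card A) \<le> sqrt N" using s by linarith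
  have B: "real (card B) * ln (sqrt N) \<le> N * ln 4"
    by (rule card_primes_times_ln_le) (use s assms in \<open>auto simp: B_def\<close>)
  have ln4: "ln 4 = 2 * ln (2::real)" using ln_realpow[of 2 2] by simp
  have lnN: "ln N = 2 * ln (sqrt N)" using assms by (simp add: ln_sqrt)
  have "real (card S) = real (card A) + real (card B)"
    using fin S by (metis card_Un_disjoint finite_Un of_nat_add)
  then have "real (card S) * ln N = 2 * (real (card A) * ln (sqrt N)) + 2 * (real (card B) * ln (sqrt N))"
    by (simp add: lnN algebra_simps)
  also have "\<dots> \<le> 2 * (sqrt N * sqrt N) + 2 * (N * ln 4)"
  proof -
    have "ln (sqrt N) \<le> sqrt N" using ln_le_minus_one[of "sqrt N"] s by linarith
    then have "real (card A) * ln (sqrt N) \<le> sqrt N * sqrt N"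
      using A s by (intro mult_mono) auto
    then show ?thesis using B by linarith
  qed
  also have "\<dots> = N * (2 + 4 * ln 2)" using assms by (simp add: ln4 algebra_simps)
  also have "\<dots> < N * 8"
    using assms ln_less_self[of 2] ln_2_less_1 by (intro mult_strict_left_mono) auto
  finally show ?thesis by simp
qed

section \<open>The dual large sieve\<close>

text \<open>Jordan's inequality: the sine is concave on [0, pi], so it lies above its chord from 0
  to pi/2.\<close>

lemma sin_ge_two_div_pi:
  assumes "0 \<le> x" "x \<le> pi / 2"
  shows "2 / pi * x \<le> sin x"
proof -
  have "concave_on {0..pi} sin"
  proof (rule f''_le0_imp_concave)
    show "(sin has_real_derivative cos x) (at x)" for x :: real by (rule DERIV_sin)
    show "(cos has_real_derivative - sin x) (at x)" for x :: real by (rule DERIV_cos)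
    show "- sin x \<le> 0" if "x \<in> {0..pi}" for x :: real using that sin_ge_zero by auto
  qed auto
  then have "(1 - 2 / pi * x) * sin 0 + (2 / pi * x) * sin (pi / 2)
      \<le> sin ((1 - 2 / pi * x) *\<^sub>R 0 + (2 / pi * x) *\<^sub>R (pi / 2))"
    by (rule concave_onD) (use assms pi_gt_zero in \<open>auto simp: field_simps\<close>)
  then show ?thesis by simp
qed

lemma norm_cis_minus_one_ge:
  assumes "\<bar>r\<bar> \<le> 1 / 2"
  shows "4 * \<bar>r\<bar> \<le> cmod (cis (2 * pi * r) - 1)"
proof -
  have "2 / pi * (pi * \<bar>r\<bar>) \<le> sin (pi * \<bar>r\<bar>)"
    using assms by (intro sin_ge_two_div_pi) auto
  then have "2 * \<bar>r\<bar> \<le> sin (pi * \<bar>r\<bar>)" by simp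
  also have "\<dots> \<le> \<bar>sin (pi * r)\<bar>" by (cases "r \<ge> 0") auto
  finally have "2 * \<bar>r\<bar> \<le> \<bar>sin (pi * r)\<bar>" .
  moreover have "cmod (cis (2 * pi * r) - 1) = 2 * \<bar>sin (pi * r)\<bar>"
  proof -
    have "cmod (cis (2 * pi * r) - 1) = cmod (cis (pi * r) * (cis (pi * r) - cis (- (pi * r))))"
      by (simp add: right_diff_distrib cis_mult mult_ac)
    also have "\<dots> = cmod (cis (pi * r) - cis (- (pi * r)))"
      by (simp add: norm_mult)
    also have "cis (pi * r) - cis (- (pi * r)) = 2 * \<i> * of_real (sin (pi * r))"
      by (simp add: complex_eq_iff)
    also have "cmod \<dots> = 2 * \<bar>sin (pi * r)\<bar>" by (simp add: norm_mult)
    finally show ?thesis .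
  qed
  ultimately show ?thesis by simp
qed

section \<open>Fejer weights and kernels at separated points\<close>

definition dirichlet_kernel :: "nat \<Rightarrow> real \<Rightarrow> complex" where
  "dirichlet_kernel M x = (\<Sum>m<M. cis (2 * pi * real m * x))"

lemma norm_dirichlet_kernel_le: "cmod (dirichlet_kernel M x) \<le> real M"
  unfolding dirichlet_kernel_def using norm_sum[of "\<lambda>m. cis (2 * pi * real m * x)" "{..<M}"] by simp

lemma dirichlet_kernel_add_int: "dirichlet_kernel M (x + of_int k) = dirichlet_kernel M x"
  unfolding dirichlet_kernel_def
proof (intro sum.cong refl)
  fix m
  have "cis (2 * pi * real m * (x + of_int k)) = cis (2 * pi * real m * x) * cis (2 * pi * (real m * of_int k))"
    by (simp add: cis_mult algebra_simps)
  also have "cis (2 * pi * (real m * of_int k)) = 1"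
    by (intro cis_multiple_2pi) auto
  finally show "cis (2 * pi * real m * (x + of_int k)) = cis (2 * pi * real m * x)" by simp
qed

lemma norm_dirichlet_kernel_le_inverse:
  assumes "\<bar>r\<bar> \<le> 1 / 2" "r \<noteq> 0"
  shows "cmod (dirichlet_kernel M r) \<le> 1 / (2 * \<bar>r\<bar>)"
proof -
  define z where "z = cis (2 * pi * r)"
  have z: "dirichlet_kernel M r = (\<Sum>m<M. z ^ m)"
    unfolding dirichlet_kernel_def z_def
  proof (intro sum.cong refl)
    fix m
    have *: "2 * pi * real m * r = real m * (2 * pi * r)" by simp
    show "cis (2 * pi * real m * r) = cis (2 * pi * r) ^ m"
      unfolding * by (rule Complex.DeMoivre[symmetric])
  qed
  have "cmod (z - 1) * cmod (dirichlet_kernel M r) = cmod (z ^ M - 1)"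
    unfolding z by (simp add: power_diff_1_eq norm_mult)
  also have "\<dots> \<le> 2"
    using norm_triangle_ineq4[of "z ^ M" 1] by (simp add: norm_power z_def)
  finally have "cmod (z - 1) * cmod (dirichlet_kernel M r) \<le> 2" .
  moreover have "4 * \<bar>r\<bar> * cmod (dirichlet_kernel M r) \<le> cmod (z - 1) * cmod (dirichlet_kernel M r)"
    unfolding z_def by (intro mult_right_mono norm_cis_minus_one_ge assms) auto
  ultimately show ?thesis using assms by (simp add: field_simps)
qed

lemma sum_inverse_squares_le: "(\<Sum>k=1..Suc n. 1 / (real k)\<^sup>2) \<le> 2 - 1 / real (Suc n)"
proof (induction n)
  case (Suc n)
  define x where "x = real (Suc n)"
  have x: "x \<ge> 1" by (simp add: x_def)
  have "1 / (x + 1)\<^sup>2 \<le> 1 / (x * (x + 1))"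
    using x by (intro divide_left_mono) (auto simp: power2_eq_square intro!: mult_right_mono)
  also have "\<dots> = 1 / x - 1 / (x + 1)" using x by (simp add: field_simps)
  finally have "1 / (x + 1)\<^sup>2 \<le> 1 / x - 1 / (x + 1)" .
  then show ?case using Suc.IH by (simp add: x_def add.commute[of 1])
qed simp

text \<open>The integer parts of r_j/\<delta> are distinct positive integers, because two points in
  the same cell of length \<delta> would be too close. So the sum is dominated by the sum of 1/(k
  \<delta>)^2 over k \<ge> 1.\<close>

lemma sum_inverse_squares_separated_pos:
  fixes r :: "'i \<Rightarrow> real"
  assumes "finite J" "\<delta> > 0" "\<And>j. j \<in> J \<Longrightarrow> \<delta> \<le> r j"
    "\<And>j k. j \<in> J \<Longrightarrow> k \<in> J \<Longrightarrow> j \<noteq> k \<Longrightarrow> \<delta> \<le> \<bar>r j - r k\<bar>"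
  shows "(\<Sum>j\<in>J. 1 / (r j)\<^sup>2) \<le> 2 / \<delta>\<^sup>2"
proof -
  define g where "g j = nat \<lfloor>r j / \<delta>\<rfloor>" for j
  have g: "1 \<le> g j" "real (g j) * \<delta> \<le> r j" "r j < (real (g j) + 1) * \<delta>" if "j \<in> J" for j
  proof -
    have "1 \<le> r j / \<delta>" using assms(2,3) that by (simp add: field_simps)
    then have *: "1 \<le> \<lfloor>r j / \<delta>\<rfloor>" by linarith
    then show "1 \<le> g j" by (simp add: g_def le_nat_iff)
    have "real (g j) = of_int \<lfloor>r j / \<delta>\<rfloor>" using * by (simp add: g_def)
    then have "real (g j) \<le> r j / \<delta>" "r j / \<delta> < real (g j) + 1" by linarith+
    then show "real (g j) * \<delta> \<le> r j" "r j < (real (g j) + 1) * \<delta>"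
      using assms(2) by (simp_all add: field_simps)
  qed
  have inj: "inj_on g J"
  proof (rule inj_onI, rule ccontr)
    fix j k assume jk: "j \<in> J" "k \<in> J" "g j = g k" "j \<noteq> k"
    then have "\<bar>r j - r k\<bar> < \<delta>"
      using g[of j] g[of k] by (auto simp: abs_less_iff algebra_simps)
    then show False using assms(4)[OF jk(1,2,4)] by simp
  qed
  obtain E where E: "g ` J \<subseteq> {..E}" using assms(1) finite_nat_iff_bounded_le by blast
  have "(\<Sum>j\<in>J. 1 / (r j)\<^sup>2) \<le> (\<Sum>j\<in>J. 1 / (real (g j) * \<delta>)\<^sup>2)"
  proof (intro sum_mono divide_left_mono power_mono)
    fix j assume j: "j \<in> J"
    have "0 < real (g j) * \<delta>" "0 < r j" using g[OF j] assms(2) assms(3)[OF j] by auto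
    then show "0 < (r j)\<^sup>2 * (real (g j) * \<delta>)\<^sup>2"
      by (intro mult_pos_pos[OF zero_less_power zero_less_power])
  qed (use g assms(2) in auto)
  also have "\<dots> = (\<Sum>k\<in>g ` J. 1 / (real k * \<delta>)\<^sup>2)"
    by (simp add: sum.reindex[OF inj])
  also have "\<dots> \<le> (\<Sum>k=1..Suc E. 1 / (real k * \<delta>)\<^sup>2)"
  proof (rule sum_mono2)
    show "g ` J \<subseteq> {1..Suc E}"
    proof
      fix k assume k: "k \<in> g ` J"
      then have "k \<le> E" using E by blast
      moreover have "1 \<le> k" using k g by auto
      ultimately show "k \<in> {1..Suc E}" by simp
    qed
  qed auto
  also have "\<dots> = (\<Sum>k=1..Suc E. 1 / (real k)\<^sup>2) / \<delta>\<^sup>2"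
    by (simp only: power_mult_distrib sum_divide_distrib divide_divide_eq_left)
  also have "\<dots> \<le> 2 / \<delta>\<^sup>2"
  proof (rule divide_right_mono)
    have "(\<Sum>k=1..Suc E. 1 / (real k)\<^sup>2) \<le> 2 - 1 / real (Suc E)" by (rule sum_inverse_squares_le)
    also have "\<dots> \<le> 2" by simp
    finally show "(\<Sum>k=1..Suc E. 1 / (real k)\<^sup>2) \<le> 2" .
  qed simp
  finally show ?thesis .
qed

lemma sum_inverse_squares_separated:
  fixes r :: "'i \<Rightarrow> real"
  assumes "finite J" "\<delta> > 0" "\<And>j. j \<in> J \<Longrightarrow> \<delta> \<le> \<bar>r j\<bar>"
    "\<And>j k. j \<in> J \<Longrightarrow> k \<in> J \<Longrightarrow> j \<noteq> k \<Longrightarrow> \<delta> \<le> \<bar>r j - r k\<bar>"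
  shows "(\<Sum>j\<in>J. 1 / (r j)\<^sup>2) \<le> 4 / \<delta>\<^sup>2"
proof -
  let ?P = "{j\<in>J. r j > 0}" and ?N = "{j\<in>J. \<not> r j > 0}"
  have "(\<Sum>j\<in>J. 1 / (r j)\<^sup>2) = (\<Sum>j\<in>?P. 1 / (r j)\<^sup>2) + (\<Sum>j\<in>?N. 1 / (r j)\<^sup>2)"
    by (subst sum.union_disjoint[symmetric]) (auto simp: assms(1) intro!: sum.cong)
  moreover have "(\<Sum>j\<in>?P. 1 / (r j)\<^sup>2) \<le> 2 / \<delta>\<^sup>2"
    by (rule sum_inverse_squares_separated_pos) (use assms in fastforce)+
  moreover have "(\<Sum>j\<in>?N. 1 / (- r j)\<^sup>2) \<le> 2 / \<delta>\<^sup>2"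
    by (rule sum_inverse_squares_separated_pos) (use assms in fastforce)+
  ultimately show ?thesis by simp
qed

definition exp_sum :: "'i set \<Rightarrow> ('i \<Rightarrow> complex) \<Rightarrow> ('i \<Rightarrow> real) \<Rightarrow> real \<Rightarrow> complex" where
  "exp_sum I c \<beta> y = (\<Sum>i\<in>I. c i * cis (2 * pi * y * \<beta> i))"

text \<open>The double sum over m, m' counts the difference n with the Fejer weight M - |n|. Its
  transform is the square of the Dirichlet kernel, which decays like 1/r^2; row sums over separated
  points therefore converge without a logarithmic loss.\<close>

lemma fejer_weighted_square_sum:
  "(\<Sum>m<M. \<Sum>m'<M. of_real ((cmod (exp_sum I c \<beta> (real m - real m')))\<^sup>2))
   = (\<Sum>i\<in>I. \<Sum>j\<in>I. c i * cnj (c j) * of_real ((cmod (dirichlet_kernel M (\<beta> i - \<beta> j)))\<^sup>2))"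
proof -
  have E: "complex_of_real ((cmod (exp_sum I c \<beta> (real m - real m')))\<^sup>2)
      = (\<Sum>i\<in>I. \<Sum>j\<in>I. c i * cnj (c j) * (cis (2 * pi * real m * (\<beta> i - \<beta> j)) * cnj (cis (2 * pi * real m' * (\<beta> i - \<beta> j)))))"
    for m m'
  proof -
    have "complex_of_real ((cmod (exp_sum I c \<beta> (real m - real m')))\<^sup>2)
       = exp_sum I c \<beta> (real m - real m') * cnj (exp_sum I c \<beta> (real m - real m'))"
      by (rule complex_norm_square)
    also have "\<dots> = (\<Sum>i\<in>I. \<Sum>j\<in>I. (c i * cis (2 * pi * (real m - real m') * \<beta> i)) * cnj (c j * cis (2 * pi * (real m - real m') * \<beta> j)))"
      unfolding exp_sum_def cnj_sum by (rule sum_product)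
    also have "\<dots> = (\<Sum>i\<in>I. \<Sum>j\<in>I. c i * cnj (c j) * (cis (2 * pi * real m * (\<beta> i - \<beta> j)) * cnj (cis (2 * pi * real m' * (\<beta> i - \<beta> j)))))"
      by (intro sum.cong refl) (simp add: cis_cnj cis_mult algebra_simps)
    finally show ?thesis .
  qed
  have D: "(\<Sum>m<M. \<Sum>m'<M. cis (2 * pi * real m * x) * cnj (cis (2 * pi * real m' * x)))
      = of_real ((cmod (dirichlet_kernel M x))\<^sup>2)" for x
    unfolding complex_norm_square dirichlet_kernel_def cnj_sum by (rule sum_product[symmetric])
  have "(\<Sum>m<M. \<Sum>m'<M. complex_of_real ((cmod (exp_sum I c \<beta> (real m - real m')))\<^sup>2))
    = (\<Sum>m<M. \<Sum>m'<M. \<Sum>i\<in>I. \<Sum>j\<in>I. c i * cnj (c j) * (cis (2 * pi * real m * (\<beta> i - \<beta> j)) * cnj (cis (2 * pi * real m' * (\<beta> i - \<beta> j)))))"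
    by (simp only: E)
  also have "\<dots> = (\<Sum>m<M. \<Sum>i\<in>I. \<Sum>m'<M. \<Sum>j\<in>I. c i * cnj (c j) * (cis (2 * pi * real m * (\<beta> i - \<beta> j)) * cnj (cis (2 * pi * real m' * (\<beta> i - \<beta> j)))))"
    by (intro sum.cong refl sum.swap)
  also have "\<dots> = (\<Sum>i\<in>I. \<Sum>m<M. \<Sum>m'<M. \<Sum>j\<in>I. c i * cnj (c j) * (cis (2 * pi * real m * (\<beta> i - \<beta> j)) * cnj (cis (2 * pi * real m' * (\<beta> i - \<beta> j)))))"
    by (rule sum.swap)
  also have "\<dots> = (\<Sum>i\<in>I. \<Sum>m<M. \<Sum>j\<in>I. \<Sum>m'<M. c i * cnj (c j) * (cis (2 * pi * real m * (\<beta> i - \<beta> j)) * cnj (cis (2 * pi * real m' * (\<beta> i - \<beta> j)))))"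
    by (intro sum.cong refl sum.swap)
  also have "\<dots> = (\<Sum>i\<in>I. \<Sum>j\<in>I. \<Sum>m<M. \<Sum>m'<M. c i * cnj (c j) * (cis (2 * pi * real m * (\<beta> i - \<beta> j)) * cnj (cis (2 * pi * real m' * (\<beta> i - \<beta> j)))))"
    by (intro sum.cong refl sum.swap)
  also have "\<dots> = (\<Sum>i\<in>I. \<Sum>j\<in>I. c i * cnj (c j) * of_real ((cmod (dirichlet_kernel M (\<beta> i - \<beta> j)))\<^sup>2))"
    by (simp only: D[symmetric] sum_distrib_left)
  finally show ?thesis .
qed

text \<open>The diagonal gives M^2. Off the diagonal the kernel depends only on the residue r_j of
  least absolute value, and these residues are separated from zero and from one another.\<close>

lemma sum_dirichlet_kernel_squares_le:
  assumes "finite I" "\<delta> > 0" "i \<in> I"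
    and sep: "\<And>i j k. i \<in> I \<Longrightarrow> j \<in> I \<Longrightarrow> i \<noteq> j \<Longrightarrow> \<delta> \<le> \<bar>\<beta> i - \<beta> j - of_int k\<bar>"
  shows "(\<Sum>j\<in>I. (cmod (dirichlet_kernel M (\<beta> i - \<beta> j)))\<^sup>2) \<le> (real M)\<^sup>2 + 1 / \<delta>\<^sup>2"
proof -
  define r where "r j = \<beta> i - \<beta> j - of_int (round (\<beta> i - \<beta> j))" for j
  have "(\<Sum>j\<in>I. (cmod (dirichlet_kernel M (\<beta> i - \<beta> j)))\<^sup>2)
      = (cmod (dirichlet_kernel M (\<beta> i - \<beta> i)))\<^sup>2 + (\<Sum>j\<in>I - {i}. (cmod (dirichlet_kernel M (\<beta> i - \<beta> j)))\<^sup>2)"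
    using assms by (intro sum.remove)
  also have "\<dots> \<le> (real M)\<^sup>2 + (\<Sum>j\<in>I - {i}. 1 / 4 * (1 / (r j)\<^sup>2))"
  proof (intro add_mono sum_mono power_mono norm_dirichlet_kernel_le)
    fix j assume j: "j \<in> I - {i}"
    have "\<delta> \<le> \<bar>r j\<bar>" unfolding r_def using j assms(3) by (intro sep) auto
    then have r0: "r j \<noteq> 0" using assms(2) by auto
    have "\<bar>r j\<bar> \<le> 1 / 2"
      unfolding r_def using of_int_round_abs_le[of "\<beta> i - \<beta> j"] by (simp add: abs_minus_commute)
    then have "cmod (dirichlet_kernel M (r j)) \<le> 1 / (2 * \<bar>r j\<bar>)"
      using r0 by (rule norm_dirichlet_kernel_le_inverse)
    moreover have "dirichlet_kernel M (\<beta> i - \<beta> j) = dirichlet_kernel M (r j)"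
      using dirichlet_kernel_add_int[of M "r j" "round (\<beta> i - \<beta> j)"] by (simp add: r_def)
    ultimately have "(cmod (dirichlet_kernel M (\<beta> i - \<beta> j)))\<^sup>2 \<le> (1 / (2 * \<bar>r j\<bar>))\<^sup>2"
      by (intro power_mono) auto
    then show "(cmod (dirichlet_kernel M (\<beta> i - \<beta> j)))\<^sup>2 \<le> 1 / 4 * (1 / (r j)\<^sup>2)"
      by (simp add: power_divide power_mult_distrib)
  qed auto
  also have "(\<Sum>j\<in>I - {i}. 1 / 4 * (1 / (r j)\<^sup>2)) = 1 / 4 * (\<Sum>j\<in>I - {i}. 1 / (r j)\<^sup>2)"
    by (rule sum_distrib_left[symmetric])
  also have "(\<Sum>j\<in>I - {i}. 1 / (r j)\<^sup>2) \<le> 4 / \<delta>\<^sup>2"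
  proof (rule sum_inverse_squares_separated)
    fix j assume "j \<in> I - {i}"
    then show "\<delta> \<le> \<bar>r j\<bar>" unfolding r_def using assms(3) by (intro sep) auto
  next
    fix j k assume jk: "j \<in> I - {i}" "k \<in> I - {i}" "j \<noteq> k"
    \<comment> \<open>Modulo 1 the common point \<beta> i drops out, so the hypothesis for the pair
      k, j separates the residues.\<close>
    have "r j - r k = \<beta> k - \<beta> j - of_int (round (\<beta> i - \<beta> j) - round (\<beta> i - \<beta> k))"
      by (simp add: r_def)
    then show "\<delta> \<le> \<bar>r j - r k\<bar>" using sep[of k j "round (\<beta> i - \<beta> j) - round (\<beta> i - \<beta> k)"] jk by auto
  qed (use assms in auto)
  finally show ?thesis by simp
qed

text \<open>A difference n \<le> K arises from M - n \<ge> M/2 pairs. The differences outside 1..K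
  are dropped by nonnegativity.\<close>

lemma sum_fejer_differences_ge:
  fixes g :: "real \<Rightarrow> real"
  assumes "\<And>y. g y \<ge> 0" "2 * K \<le> M"
  shows "real M / 2 * (\<Sum>n=1..K. g (real n)) \<le> (\<Sum>m<M. \<Sum>m'<M. g (real m - real m'))"
proof -
  define \<phi> where "\<phi> = (\<lambda>(n::nat, m'::nat). (m' + n, m'))"
  have inj: "inj_on \<phi> (SIGMA n:{1..K}. {..<M - n})" by (auto simp: inj_on_def \<phi>_def)
  have "real M / 2 * (\<Sum>n=1..K. g (real n)) = (\<Sum>n=1..K. real M / 2 * g (real n))"
    by (rule sum_distrib_left)
  also have "\<dots> \<le> (\<Sum>n=1..K. \<Sum>m'<M - n. g (real n))"
  proof (rule sum_mono)
    fix n assume "n \<in> {1..K}"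
    then have "real M / 2 \<le> real (M - n)" using assms(2) by (simp add: of_nat_diff)
    then show "real M / 2 * g (real n) \<le> (\<Sum>m'<M - n. g (real n))"
      using assms(1)[of "real n"] mult_right_mono[of "real M / 2" "real (M - n)" "g (real n)"] by simp
  qed
  also have "\<dots> = (\<Sum>x\<in>(SIGMA n:{1..K}. {..<M - n}). g (real (fst x)))"
    by (subst sum.Sigma) (auto simp: case_prod_unfold)
  also have "\<dots> = (\<Sum>x\<in>\<phi> ` (SIGMA n:{1..K}. {..<M - n}). g (real (fst x) - real (snd x)))"
    by (subst sum.reindex[OF inj]) (auto simp: \<phi>_def case_prod_unfold)
  also have "\<dots> \<le> (\<Sum>x\<in>{..<M} \<times> {..<M}. g (real (fst x) - real (snd x)))"
    by (rule sum_mono2) (use assms(1) in \<open>auto simp: \<phi>_def\<close>)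
  also have "\<dots> = (\<Sum>m<M. \<Sum>m'<M. g (real m - real m'))"
    by (subst sum.cartesian_product) (simp add: case_prod_unfold)
  finally show ?thesis .
qed

lemma dual_large_sieve:
  assumes "finite I" "\<delta> > 0"
    and sep: "\<And>i j k. i \<in> I \<Longrightarrow> j \<in> I \<Longrightarrow> i \<noteq> j \<Longrightarrow> \<delta> \<le> \<bar>\<beta> i - \<beta> j - of_int k\<bar>"
  shows "(\<Sum>n=1..K. (cmod (exp_sum I c \<beta> (real n)))\<^sup>2) \<le> (4 * real K + 4 / \<delta> + 2) * (\<Sum>i\<in>I. (cmod (c i))\<^sup>2)"
proof -
  \<comment> \<open>M \<ge> 2K serves the Fejer weights, and M \<ge> 1/\<delta> keeps the
    off-diagonal term 1/\<delta>^2 below M/\<delta>. The two requirements are added instead of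
    taking a maximum; rounding up costs at most 1.\<close>
  define M where "M = nat \<lceil>2 * real K + 1 / \<delta>\<rceil>"
  define C where "C = (\<Sum>i\<in>I. (cmod (c i))\<^sup>2)"
  define d where "d i j = (cmod (dirichlet_kernel M (\<beta> i - \<beta> j)))\<^sup>2" for i j
  have C: "C \<ge> 0" unfolding C_def by (intro sum_nonneg) auto
  have M1: "2 * real K + 1 / \<delta> \<le> real M" unfolding M_def by (rule real_nat_ceiling_ge)
  have \<delta>': "1 / \<delta> > 0" using assms by simp
  have M2: "real M \<le> 2 * real K + 1 / \<delta> + 1"
  proof -
    have "0 \<le> \<lceil>2 * real K + 1 / \<delta>\<rceil>" using \<delta>' by (smt (verit) of_nat_0_le_iff zero_le_ceiling)
    then show ?thesis unfolding M_def using of_int_ceiling_le_add_one[of "2 * real K + 1 / \<delta>"] by simp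
  qed
  have M0: "real M > 0" using M1 \<delta>' by (smt (verit) of_nat_0_le_iff)
  have KM: "2 * K \<le> M" using M1 \<delta>' by linarith
  have d_sym: "d i j = d j i" for i j
  proof -
    have "dirichlet_kernel M (\<beta> i - \<beta> j) = cnj (dirichlet_kernel M (\<beta> j - \<beta> i))"
      unfolding dirichlet_kernel_def by (simp add: cis_cnj algebra_simps)
    then show ?thesis by (simp add: d_def)
  qed
  have "(\<Sum>m<M. \<Sum>m'<M. (cmod (exp_sum I c \<beta> (real m - real m')))\<^sup>2)
      = cmod (\<Sum>m<M. \<Sum>m'<M. of_real ((cmod (exp_sum I c \<beta> (real m - real m')))\<^sup>2))"
    by (subst of_real_sum[symmetric], subst of_real_sum[symmetric], subst norm_of_real) (auto intro!: sum_nonneg abs_of_nonneg[symmetric])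
  also have "\<dots> = cmod (\<Sum>i\<in>I. \<Sum>j\<in>I. c i * cnj (c j) * of_real (d i j))"
    unfolding fejer_weighted_square_sum d_def ..
  also have "\<dots> \<le> (\<Sum>i\<in>I. \<Sum>j\<in>I. cmod (c i) * cmod (c j) * d i j)"
    by (intro order_trans[OF norm_sum] sum_mono) (auto simp: norm_mult norm_power d_def)
  \<comment> \<open>Schur's test: \<open>|c\<^sub>i c\<^sub>j|\<close> is at most the mean of the squares, and the kernel is symmetric.\<close>
  also have "\<dots> \<le> (\<Sum>i\<in>I. \<Sum>j\<in>I. (cmod (c i))\<^sup>2 / 2 * d i j + (cmod (c j))\<^sup>2 / 2 * d i j)"
  proof (intro sum_mono)
    fix i j
    have "cmod (c i) * cmod (c j) \<le> (cmod (c i))\<^sup>2 / 2 + (cmod (c j))\<^sup>2 / 2"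
      using sum_squares_bound[of "cmod (c i)" "cmod (c j)"] by simp
    then have "cmod (c i) * cmod (c j) * d i j \<le> ((cmod (c i))\<^sup>2 / 2 + (cmod (c j))\<^sup>2 / 2) * d i j"
      by (intro mult_right_mono) (auto simp: d_def)
    then show "cmod (c i) * cmod (c j) * d i j \<le> (cmod (c i))\<^sup>2 / 2 * d i j + (cmod (c j))\<^sup>2 / 2 * d i j"
      by (simp add: distrib_right)
  qed
  also have "\<dots> = (\<Sum>i\<in>I. \<Sum>j\<in>I. (cmod (c i))\<^sup>2 / 2 * d i j) + (\<Sum>i\<in>I. \<Sum>j\<in>I. (cmod (c j))\<^sup>2 / 2 * d i j)"
    by (simp add: sum.distrib)
  also have "(\<Sum>i\<in>I. \<Sum>j\<in>I. (cmod (c j))\<^sup>2 / 2 * d i j) = (\<Sum>j\<in>I. \<Sum>i\<in>I. (cmod (c j))\<^sup>2 / 2 * d j i)"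
    by (subst sum.swap) (intro sum.cong refl, subst d_sym, rule refl)
  also have "(\<Sum>i\<in>I. \<Sum>j\<in>I. (cmod (c i))\<^sup>2 / 2 * d i j) + \<dots> = (\<Sum>i\<in>I. (cmod (c i))\<^sup>2 * (\<Sum>j\<in>I. d i j))"
    unfolding sum_distrib_left sum.distrib[symmetric] by (intro sum.cong refl) simp
  also have "\<dots> \<le> (\<Sum>i\<in>I. (cmod (c i))\<^sup>2 * ((real M)\<^sup>2 + 1 / \<delta>\<^sup>2))"
    unfolding d_def by (intro sum_mono mult_left_mono sum_dirichlet_kernel_squares_le assms) auto
  also have "\<dots> = ((real M)\<^sup>2 + 1 / \<delta>\<^sup>2) * C" unfolding C_def sum_distrib_left by (intro sum.cong refl mult.commute)
  finally have "real M / 2 * (\<Sum>n=1..K. (cmod (exp_sum I c \<beta> (real n)))\<^sup>2) \<le> ((real M)\<^sup>2 + 1 / \<delta>\<^sup>2) * C"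
    by (rule order_trans[rotated]) (rule sum_fejer_differences_ge[OF _ KM], simp)
  then have "(\<Sum>n=1..K. (cmod (exp_sum I c \<beta> (real n)))\<^sup>2) \<le> 2 / real M * (((real M)\<^sup>2 + 1 / \<delta>\<^sup>2) * C)"
    using M0 by (simp add: field_simps)
  also have "\<dots> = (2 * real M + 2 / \<delta> * (1 / \<delta> / real M)) * C"
    using M0 by (simp add: field_simps power2_eq_square)
  also have "\<dots> \<le> (2 * (2 * real K + 1 / \<delta> + 1) + 2 / \<delta> * 1) * C"
  proof (intro mult_right_mono add_mono mult_left_mono M2 C)
    have "1 / \<delta> \<le> real M" using M1 by (smt (verit) of_nat_0_le_iff)
    then show "1 / \<delta> / real M \<le> 1" using M0 by (simp only: divide_le_eq_1_pos)
  qed (use assms in auto)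
  also have "\<dots> = (4 * real K + 4 / \<delta> + 2) * C" by (simp add: algebra_simps)
  finally show ?thesis by (simp add: C_def)
qed

section \<open>The Selberg kernel\<close>

definition fraction_sum :: "nat set \<Rightarrow> (nat \<Rightarrow> nat) \<Rightarrow> real" where
  "fraction_sum D a = (\<Sum>p\<in>D. real (a p) / real p)"

text \<open>Over the common denominator, every term of the numerator except the one of p is
  divisible by p, and that one is b_p times an integer prime to p.\<close>

lemma sum_over_primes_numerator:
  fixes b :: "nat \<Rightarrow> int"
  assumes "finite U" "\<And>p. p \<in> U \<Longrightarrow> prime p"
  shows "\<exists>m :: int. (\<Sum>p\<in>U. of_int (b p) / real p) = of_int m / real (\<Prod>U) \<and>
    (\<forall>p\<in>U. \<not> int p dvd b p \<longrightarrow> \<not> int p dvd m)"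
proof -
  define m where "m = (\<Sum>p\<in>U. b p * int (\<Prod>(U - {p})))"
  show ?thesis
  proof (intro exI conjI ballI impI)
    have pos: "\<Prod>U > 0" by (intro prod_pos) (auto dest: assms(2) prime_gt_0_nat)
    show "(\<Sum>p\<in>U. of_int (b p) / real p) = of_int m / real (\<Prod>U)"
      unfolding m_def of_int_sum sum_divide_distrib
    proof (intro sum.cong refl)
      fix p assume p: "p \<in> U"
      have "real (\<Prod>U) = real p * real (\<Prod>(U - {p}))"
        using assms(1) p by (subst prod.remove[of U p]) simp_all
      moreover have "p > 0" "\<Prod>(U - {p}) > 0"
        using p by (auto intro!: prod_pos dest: assms(2) prime_gt_0_nat)
      then have "real p \<noteq> 0" "real (\<Prod>(U - {p})) \<noteq> 0" by (simp_all del: of_nat_prod)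
      ultimately show "of_int (b p) / real p = of_int (b p * int (\<Prod>(U - {p}))) / real (\<Prod>U)"
        by (simp del: of_nat_prod)
    qed
  next
    fix p assume p: "p \<in> U" and ndvd: "\<not> int p dvd b p"
    have pp: "prime (int p)" using assms(2)[OF p] by simp
    have "\<not> p dvd \<Prod>(U - {p})"
    proof
      assume "p dvd \<Prod>(U - {p})"
      then obtain q where "q \<in> U - {p}" "p dvd q"
        using prime_dvd_prod_iff[of "U - {p}" p "\<lambda>x. x"] assms p by auto
      then show False using assms p by (metis Diff_iff insertI1 primes_dvd_imp_eq)
    qed
    then have "\<not> int p dvd int (\<Prod>(U - {p}))" by (simp del: of_nat_prod)
    then have 1: "\<not> int p dvd b p * int (\<Prod>(U - {p}))"
      using ndvd pp prime_dvd_mult_iff by blast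
    have 2: "int p dvd (\<Sum>q\<in>U - {p}. b q * int (\<Prod>(U - {q})))"
    proof (rule dvd_sum)
      fix q assume q: "q \<in> U - {p}"
      have "p dvd \<Prod>(U - {q})" using assms(1) p q by (intro dvd_prodI) auto
      then show "int p dvd b q * int (\<Prod>(U - {q}))" by (simp del: of_nat_prod add: dvd_mult)
    qed
    have "m = b p * int (\<Prod>(U - {p})) + (\<Sum>q\<in>U - {p}. b q * int (\<Prod>(U - {q})))"
      unfolding m_def using assms(1) p by (rule sum.remove)
    then show "\<not> int p dvd m" using 1 dvd_add_left_iff[OF 2] by simp
  qed
qed

text \<open>Distinct labels give points distinct modulo 1: at some prime the numerators differ by a
  nonzero integer of absolute value below p, so even the numerator over the common denominator is
  not divisible by p.\<close>

lemma fraction_sum_diff: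
  assumes "finite D" "finite D'" "\<And>p. p \<in> D \<union> D' \<Longrightarrow> prime p"
    and "a \<in> (\<Pi>\<^sub>E p\<in>D. {1..<p})" "a' \<in> (\<Pi>\<^sub>E p\<in>D'. {1..<p})"
  shows "\<exists>m :: int. fraction_sum D a - fraction_sum D' a' = of_int m / real (\<Prod>(D \<union> D')) \<and>
    ((D, a) \<noteq> (D', a') \<longrightarrow> \<not> int (\<Prod>(D \<union> D')) dvd m)"
proof -
  \<comment> \<open>A prime outside the support counts as numerator 0. As genuine numerators lie in
    1..p-1, vanishing of all b_p forces equal supports as well as equal numerators.\<close>
  define b where "b p = (if p \<in> D then int (a p) else 0) - (if p \<in> D' then int (a' p) else 0)" for p
  obtain m where m: "(\<Sum>p\<in>D \<union> D'. of_int (b p) / real p) = of_int m / real (\<Prod>(D \<union> D'))"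
    "\<forall>p\<in>D \<union> D'. \<not> int p dvd b p \<longrightarrow> \<not> int p dvd m"
    using sum_over_primes_numerator[OF finite_UnI[OF assms(1,2)] assms(3), of b] by blast
  show ?thesis
  proof (intro exI conjI impI)
    have 1: "fraction_sum D a = (\<Sum>p\<in>D \<union> D'. (if p \<in> D then real (a p) else 0) / real p)"
      unfolding fraction_sum_def using assms(1,2) by (intro sum.mono_neutral_cong_left) auto
    have 2: "fraction_sum D' a' = (\<Sum>p\<in>D \<union> D'. (if p \<in> D' then real (a' p) else 0) / real p)"
      unfolding fraction_sum_def using assms(1,2) by (intro sum.mono_neutral_cong_left) auto
    have 3: "(if p \<in> D then real (a p) else 0) / real p - (if p \<in> D' then real (a' p) else 0) / real p
        = of_int (b p) / real p" for p
      unfolding b_def by (simp add: diff_divide_distrib[symmetric])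
    have "fraction_sum D a - fraction_sum D' a' = (\<Sum>p\<in>D \<union> D'. of_int (b p) / real p)"
      unfolding 1 2 sum_subtractf[symmetric] 3 ..
    then show "fraction_sum D a - fraction_sum D' a' = of_int m / real (\<Prod>(D \<union> D'))"
      using m(1) by (rule trans)
  next
    assume neq: "(D, a) \<noteq> (D', a')"
    have range: "1 \<le> a p \<and> a p < p" if "p \<in> D" for p
      using PiE_mem[OF assms(4) that] by simp
    have range': "1 \<le> a' p \<and> a' p < p" if "p \<in> D'" for p
      using PiE_mem[OF assms(5) that] by simp
    have "\<exists>p\<in>D \<union> D'. b p \<noteq> 0"
    proof (rule ccontr)
      assume "\<not> ?thesis"
      then have b0: "b p = 0" if "p \<in> D \<union> D'" for p using that by blast
      have "p \<in> D \<longleftrightarrow> p \<in> D'" for p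
        using b0[of p] range[of p] range'[of p]
        by (cases "p \<in> D"; cases "p \<in> D'") (simp_all add: b_def)
      then have D: "D = D'" by blast
      have "a p = a' p" if "p \<in> D" for p using b0[of p] that D by (simp add: b_def)
      then have "a = a'" using PiE_ext[OF assms(4) assms(5)[folded D]] by blast
      then show False using D neq by simp
    qed
    then obtain p where p: "p \<in> D \<union> D'" "b p \<noteq> 0" by blast
    have "\<bar>b p\<bar> < int p"
      using range[of p] range'[of p] p(1)
      by (cases "p \<in> D"; cases "p \<in> D'") (simp_all add: b_def abs_less_iff)
    then have "\<not> int p dvd b p" using dvd_imp_le_int[OF p(2), of "int p"] by linarith
    then have "\<not> int p dvd m" using m(2) p(1) by blast
    moreover have "p dvd \<Prod>(D \<union> D')" using p(1) assms(1,2) by (intro dvd_prodI) auto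
    then have "int p dvd int (\<Prod>(D \<union> D'))" by (simp del: of_nat_prod)
    ultimately show "\<not> int (\<Prod>(D \<union> D')) dvd m" using dvd_trans by blast
  qed
qed

text \<open>The sum over all residues is a vanishing geometric sum, and the omitted residue 0
  contributes 1. This is the Ramanujan sum of prime modulus.\<close>

lemma sum_cis_nonzero_residues:
  assumes "p > 0" "\<not> p dvd n"
  shows "(\<Sum>a\<in>{1..<p}. cis (2 * pi * real n * (real a / real p))) = -1"
proof -
  define w where "w = cis (2 * pi * (real n / real p))"
  have wa: "cis (2 * pi * real n * (real a / real p)) = w ^ a" for a
  proof -
    have *: "2 * pi * real n * (real a / real p) = real a * (2 * pi * (real n / real p))" by simp
    show ?thesis unfolding * w_def by (rule Complex.DeMoivre[symmetric])
  qed
  have "w \<noteq> 1"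
  proof
    assume "w = 1"
    then have "cos (2 * pi * (real n / real p)) = 1" by (simp add: w_def complex_eq_iff)
    then obtain k :: int where "2 * pi * (real n / real p) = of_int k * 2 * pi"
      using cos_one_2pi_int by blast
    then have "(2 * pi) * (real n / real p) = (2 * pi) * of_int k" by (simp only: mult_ac)
    then have "real n / real p = of_int k"
      using mult_left_cancel[of "2 * pi" "real n / real p" "of_int k"] pi_neq_zero by linarith
    then have "real n = of_int k * real p" using assms(1) by (simp add: field_simps)
    then have "of_int (int n) = (of_int (k * int p) :: real)" by simp
    then have "int n = k * int p" by (simp only: of_int_eq_iff)
    then have "int p dvd int n" by simp
    then show False using assms(2) by simp
  qed
  moreover have "w ^ p = 1"
  proof -
    have "w ^ p = cis (real p * (2 * pi * (real n / real p)))" unfolding w_def by (rule Complex.DeMoivre)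
    also have "real p * (2 * pi * (real n / real p)) = 2 * pi * real n" using assms(1) by simp
    also have "cis (2 * pi * real n) = 1" by (rule cis_multiple_2pi) auto
    finally show ?thesis .
  qed
  ultimately have "(\<Sum>a<p. w ^ a) = 0" by (simp add: sum_gp_strict)
  moreover have "{..<p} = insert 0 {1..<p}" using assms(1) by auto
  ultimately have "1 + (\<Sum>a\<in>{1..<p}. w ^ a) = 0" by simp
  then show ?thesis unfolding wa by (simp add: eq_neg_iff_add_eq_0 add.commute)
qed

text \<open>The exponential is multiplicative over the coordinates, so the sum splits into prime
  moduli: c_q(n) = \<mu>(q) for n coprime to q.\<close>

lemma sum_cis_fraction_sum:
  assumes "finite D" "\<And>p. p \<in> D \<Longrightarrow> prime p \<and> \<not> p dvd n"
  shows "(\<Sum>a\<in>(\<Pi>\<^sub>E p\<in>D. {1..<p}). cis (2 * pi * real n * fraction_sum D a)) = (-1) ^ card D"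
proof -
  have "cis (2 * pi * real n * fraction_sum D a) = (\<Prod>p\<in>D. cis (2 * pi * real n * (real (a p) / real p)))" for a
    unfolding fraction_sum_def sum_distrib_left using assms(1)
    by (induction D rule: finite_induct) (simp_all add: cis_mult[symmetric])
  then have "(\<Sum>a\<in>(\<Pi>\<^sub>E p\<in>D. {1..<p}). cis (2 * pi * real n * fraction_sum D a))
      = (\<Prod>p\<in>D. \<Sum>a\<in>{1..<p}. cis (2 * pi * real n * (real a / real p)))"
    by (subst prod_sum_PiE) (use assms(1) in auto)
  also have "\<dots> = (\<Prod>p\<in>D. -1)"
    by (intro prod.cong refl sum_cis_nonzero_residues) (use assms(2) prime_gt_0_nat in auto)
  finally show ?thesis by simp
qed

text \<open>By the Chinese remainder theorem the reduced fractions with denominator \<open>\<Prod>D\<close> are, modulo 1, the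
  sums \<open>\<Sum>\<^bsub>p \<in> D\<^esub> a\<^sub>p/p\<close> with \<open>0 < a\<^sub>p < p\<close>. In this form Ramanujan sums factor over \<open>D\<close>.\<close>

definition sieve_points :: "real \<Rightarrow> real \<Rightarrow> (nat set \<times> (nat \<Rightarrow> nat)) set" where
  "sieve_points z0 Q = (SIGMA D:sieve_supports z0 Q. \<Pi>\<^sub>E p\<in>D. {1..<p})"

text \<open>For q = \<Prod>D this is \<mu>(q)/\<phi>(q), the sign being distributed over the
  primes.\<close>

definition sieve_weight :: "nat set \<Rightarrow> real" where
  "sieve_weight D = (\<Prod>p\<in>D. - 1 / (real p - 1))"

lemma finite_sieve_points [simp]: "finite (sieve_points z0 Q)"
  unfolding sieve_points_def
  by (intro finite_SigmaI finite_PiE finite_sieve_supports) (auto simp: sieve_supports_def)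

text \<open>A prime n > Q is divisible by no prime of a support, so every Ramanujan sum equals
  \<mu>(q) and cancels the sign of the weight. The kernel is thus constant on these primes.\<close>

lemma sieve_points_sum_eq:
  assumes "prime n" "Q < real n"
  shows "(\<Sum>(D, a)\<in>sieve_points z0 Q. of_real (sieve_weight D) * cis (2 * pi * real n * fraction_sum D a))
    = complex_of_real (sieve_mass z0 Q)"
proof -
  have "(\<Sum>(D, a)\<in>sieve_points z0 Q. of_real (sieve_weight D) * cis (2 * pi * real n * fraction_sum D a))
     = (\<Sum>D\<in>sieve_supports z0 Q. \<Sum>a\<in>(\<Pi>\<^sub>E p\<in>D. {1..<p}). of_real (sieve_weight D) * cis (2 * pi * real n * fraction_sum D a))"
    unfolding sieve_points_def
    by (intro sum.Sigma[symmetric] finite_sieve_supports ballI finite_PiE) (auto simp: sieve_supports_def)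
  also have "\<dots> = (\<Sum>D\<in>sieve_supports z0 Q. of_real (\<Prod>p\<in>D. 1 / (real p - 1)))"
  proof (intro sum.cong refl)
    fix D assume D: "D \<in> sieve_supports z0 Q"
    have pr: "prime p \<and> \<not> p dvd n" if "p \<in> D" for p
    proof -
      have "prime p" using D that by (auto simp: sieve_supports_def)
      moreover have "p \<noteq> n" using sieve_supports_le[OF D that] assms(2) by auto
      ultimately show ?thesis using assms(1) primes_dvd_imp_eq by blast
    qed
    have fin: "finite D" using D by (simp add: sieve_supports_def)
    have "(\<Sum>a\<in>(\<Pi>\<^sub>E p\<in>D. {1..<p}). complex_of_real (sieve_weight D) * cis (2 * pi * real n * fraction_sum D a))
        = of_real (sieve_weight D) * (-1) ^ card D"
      unfolding sum_distrib_left[symmetric] using sum_cis_fraction_sum[OF fin pr] by simp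
    also have "\<dots> = of_real (\<Prod>p\<in>D. (- 1 / (real p - 1)) * (- 1))"
      unfolding sieve_weight_def prod.distrib by simp
    also have "(\<Prod>p\<in>D. (- 1 / (real p - 1)) * (- 1)) = (\<Prod>p\<in>D. 1 / (real p - 1))" by simp
    finally show "(\<Sum>a\<in>(\<Pi>\<^sub>E p\<in>D. {1..<p}). complex_of_real (sieve_weight D) * cis (2 * pi * real n * fraction_sum D a))
      = of_real (\<Prod>p\<in>D. 1 / (real p - 1))" .
  qed
  finally show ?thesis by (simp add: sieve_mass_def)
qed

text \<open>Each q carries \<phi>(q) points of squared weight 1/\<phi>(q)^2. The total agrees with
  the constant value of the kernel on primes, which is why amplification gains exactly one factor
  \<open>sieve_mass\<close>.\<close>

lemma sieve_points_square_sum_eq: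
  "(\<Sum>(D, a)\<in>sieve_points z0 Q. (sieve_weight D)\<^sup>2) = sieve_mass z0 Q"
proof -
  have "(\<Sum>(D, a)\<in>sieve_points z0 Q. (sieve_weight D)\<^sup>2)
     = (\<Sum>D\<in>sieve_supports z0 Q. \<Sum>a\<in>(\<Pi>\<^sub>E p\<in>D. {1..<p}). (sieve_weight D)\<^sup>2)"
    unfolding sieve_points_def
    by (intro sum.Sigma[symmetric] finite_sieve_supports ballI finite_PiE) (auto simp: sieve_supports_def)
  also have "\<dots> = sieve_mass z0 Q"
    unfolding sieve_mass_def
  proof (intro sum.cong refl)
    fix D assume D: "D \<in> sieve_supports z0 Q"
    have "(\<Sum>a\<in>(\<Pi>\<^sub>E p\<in>D. {1..<p}). (sieve_weight D)\<^sup>2) = real (\<Prod>p\<in>D. p - 1) * (sieve_weight D)\<^sup>2"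
      using D by (simp add: card_PiE sieve_supports_def)
    also have "\<dots> = (\<Prod>p\<in>D. real (p - 1) * (- 1 / (real p - 1))\<^sup>2)"
      unfolding sieve_weight_def prod_power_distrib prod.distrib by simp
    also have "\<dots> = (\<Prod>p\<in>D. 1 / (real p - 1))"
    proof (intro prod.cong refl)
      fix p assume "p \<in> D"
      then have "p \<ge> 2" using D prime_ge_2_nat by (auto simp: sieve_supports_def)
      then have "real (p - 1) = real p - 1" "real p - 1 \<noteq> 0" by (auto simp: of_nat_diff)
      then show "real (p - 1) * (- 1 / (real p - 1))\<^sup>2 = 1 / (real p - 1)"
        by (simp add: power2_eq_square)
    qed
    finally show "(\<Sum>a\<in>(\<Pi>\<^sub>E p\<in>D. {1..<p}). (sieve_weight D)\<^sup>2) = (\<Prod>p\<in>D. 1 / (real p - 1))" .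
  qed
  finally show ?thesis .
qed

lemma fraction_sum_sieve_points_diff:
  assumes "(D, a) \<in> sieve_points z0 Q" "(D', a') \<in> sieve_points z0 Q"
  shows "\<exists>(m :: int) (q :: nat). fraction_sum D a - fraction_sum D' a' = of_int m / real q \<and>
    0 < q \<and> real q \<le> Q * Q \<and> (\<forall>p. prime p \<longrightarrow> p dvd q \<longrightarrow> z0 \<le> real p) \<and>
    ((D, a) \<noteq> (D', a') \<longrightarrow> \<not> int q dvd m)"
proof -
  have D: "finite D" "\<And>p. p \<in> D \<Longrightarrow> prime p \<and> z0 \<le> real p" "real (\<Prod>D) \<le> Q" "a \<in> (\<Pi>\<^sub>E p\<in>D. {1..<p})"
    using assms(1) by (auto simp: sieve_points_def sieve_supports_def)
  have D': "finite D'" "\<And>p. p \<in> D' \<Longrightarrow> prime p \<and> z0 \<le> real p" "real (\<Prod>D') \<le> Q" "a' \<in> (\<Pi>\<^sub>E p\<in>D'. {1..<p})"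
    using assms(2) by (auto simp: sieve_points_def sieve_supports_def)
  have pr: "prime p" if "p \<in> D \<union> D'" for p using that D(2) D'(2) by blast
  obtain m where m: "fraction_sum D a - fraction_sum D' a' = of_int m / real (\<Prod>(D \<union> D'))"
    "(D, a) \<noteq> (D', a') \<longrightarrow> \<not> int (\<Prod>(D \<union> D')) dvd m"
    using fraction_sum_diff[OF D(1) D'(1) pr D(4) D'(4)] by blast
  show ?thesis
  proof (intro exI conjI allI impI)
    show "fraction_sum D a - fraction_sum D' a' = of_int m / real (\<Prod>(D \<union> D'))" by (rule m(1))
    show "\<not> int (\<Prod>(D \<union> D')) dvd m" if "(D, a) \<noteq> (D', a')" using m(2) that by blast
    show "0 < \<Prod>(D \<union> D')"
      using D(2) D'(2) by (intro prod_pos) (auto dest: prime_gt_0_nat)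
    have "\<Prod>(D \<union> D') = \<Prod>D * \<Prod>(D' - D)"
      using prod.union_disjoint[of D "D' - D" "\<lambda>p. p"] D(1) D'(1) by simp
    also have "\<dots> \<le> \<Prod>D * \<Prod>D'"
    proof (rule mult_left_mono)
      have "\<Prod>D' > 0" using D'(2) by (intro prod_pos) (auto dest: prime_gt_0_nat)
      then show "\<Prod>(D' - D) \<le> \<Prod>D'"
        by (intro dvd_imp_le prod_dvd_prod_subset D'(1)) auto
    qed simp
    finally have "real (\<Prod>(D \<union> D')) \<le> real (\<Prod>D * \<Prod>D')" by (rule of_nat_mono)
    also have "\<dots> = real (\<Prod>D) * real (\<Prod>D')" by (rule of_nat_mult)
    also have "\<dots> \<le> Q * Q"
      using D(3) D'(3) by (intro mult_mono) (auto intro: order_trans[rotated] simp del: of_nat_prod)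
    finally show "real (\<Prod>(D \<union> D')) \<le> Q * Q" .
  next
    fix p assume p: "prime p" "p dvd \<Prod>(D \<union> D')"
    then obtain q where "q \<in> D \<union> D'" "p dvd q"
      using prime_dvd_prod_iff[of "D \<union> D'" p "\<lambda>x. x"] D(1) D'(1) by auto
    then show "z0 \<le> real p" using D(2) D'(2) p(1) by (metis Un_iff primes_dvd_imp_eq)
  qed
qed

text \<open>Amplification: multiplying by the kernel scales the values on \<open>S\<close> by G and
  the squared norm of the coefficients by G. The large sieve over all integers up to N then yields a
  saving 1/G over primes.\<close>

lemma prime_mean_value_le:
  fixes X :: "'x set" and r :: "'x \<Rightarrow> real" and h :: "'x set \<Rightarrow> complex"
  assumes "finite X" "2 \<le> z0" "z0 \<le> N" "0 < \<kappa>" "\<kappa> \<le> 1 / 2" "\<delta> > 0"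
    and sep: "\<And>A B (a::int) q. A \<subseteq> X \<Longrightarrow> B \<subseteq> X \<Longrightarrow> A \<noteq> B \<Longrightarrow> 0 < q \<Longrightarrow> real q \<le> N powr \<kappa> \<Longrightarrow>
        (\<And>p. prime p \<Longrightarrow> p dvd q \<Longrightarrow> z0 \<le> real p) \<Longrightarrow> \<delta> \<le> \<bar>sum r A - sum r B - of_int a / real q\<bar>"
    and S: "S \<subseteq> {p. prime p \<and> N powr \<kappa> \<le> real p \<and> real p \<le> N}"
  shows "(\<Sum>p\<in>S. (cmod (exp_sum (Pow X) h (sum r) (real p)))\<^sup>2)
    \<le> 400 * (N + 1 / \<delta>) * ln z0 / (\<kappa> * ln N) * (\<Sum>A\<in>Pow X. (cmod (h A))\<^sup>2)"
proof -
  \<comment> \<open>The square Q * Q = N powr \<kappa> bounds the denominators of differences, and Q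
    < N powr \<kappa> puts every prime of \<open>S\<close> beyond the sieve level.\<close>
  define Q where "Q = N powr (\<kappa> / 2)"
  define G where "G = sieve_mass z0 Q"
  \<comment> \<open>The second entry handles equal subsets: there only fractions differ, by at least
    1/q \<ge> 1/N.\<close>
  define \<delta>1 where "\<delta>1 = min \<delta> (1 / N)"
  define I where "I = Pow X \<times> sieve_points z0 Q"
  define \<beta> where "\<beta> = (\<lambda>(A, D, a). sum r A + fraction_sum D a)"
  define c where "c = (\<lambda>(A, D, a :: nat \<Rightarrow> nat). h A * of_real (sieve_weight D))"
  define H where "H = (\<Sum>A\<in>Pow X. (cmod (h A))\<^sup>2)"
  define K where "K = nat \<lfloor>N\<rfloor>"
  have N: "N \<ge> 2" using assms by simp
  have lnN: "ln N > 0" using N by simp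
  have lnz: "ln z0 > 0" using assms(2) by simp
  have Q2: "Q * Q = N powr \<kappa>" unfolding Q_def by (simp flip: powr_add)
  have lnQ: "ln Q = \<kappa> / 2 * ln N" unfolding Q_def using N by (simp add: ln_powr)
  have Q1: "Q > 1" unfolding Q_def using N assms(4) by simp
  have "Q < Q * Q" using Q1 by simp
  then have QN: "Q < N powr \<kappa>" by (simp add: Q2)
  have Nk: "N powr \<kappa> \<le> N" using powr_mono[of \<kappa> 1 N] N assms(5) by simp
  have \<delta>1: "\<delta>1 > 0" unfolding \<delta>1_def using assms(6) N by simp
  have H0: "H \<ge> 0" unfolding H_def by (intro sum_nonneg) auto
  have G1: "ln Q \<le> 22 * ln z0 * G" unfolding G_def using assms(2) Q1 by (intro ln_le_sieve_mass) auto
  have "0 < ln Q" using Q1 by simp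
  then have "0 < 22 * ln z0 * G" using G1 by linarith
  then have G0: "G > 0" using lnz by (simp add: zero_less_mult_iff)
  have finS: "finite S"
    by (rule finite_subset[of _ "{..K}"]) (use S in \<open>auto simp: K_def le_nat_floor\<close>)
  have sep1: "\<delta>1 \<le> \<bar>\<beta> i - \<beta> j - of_int k\<bar>" if ij: "i \<in> I" "j \<in> I" "i \<noteq> j" for i j and k :: int
  proof -
    obtain A D a where i: "i = (A, D, a)" "A \<subseteq> X" "(D, a) \<in> sieve_points z0 Q"
      using ij(1) unfolding I_def by auto
    obtain B D' a' where j: "j = (B, D', a')" "B \<subseteq> X" "(D', a') \<in> sieve_points z0 Q"
      using ij(2) unfolding I_def by auto
    obtain m q where mq: "fraction_sum D a - fraction_sum D' a' = of_int m / real q"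
      "0 < q" "real q \<le> Q * Q" "\<forall>p. prime p \<longrightarrow> p dvd q \<longrightarrow> z0 \<le> real p"
      "(D, a) \<noteq> (D', a') \<longrightarrow> \<not> int q dvd m"
      using fraction_sum_sieve_points_diff[OF i(3) j(3)] by blast
    \<comment> \<open>The integer translate k is absorbed into the numerator over q, so separation
      modulo 1 follows from a bound valid for all numerators.\<close>
    have \<beta>: "\<beta> i - \<beta> j - of_int k = sum r A - sum r B - of_int (k * int q - m) / real q"
    proof -
      have "of_int (k * int q - m) / real q = of_int k - of_int m / real q"
        using mq(2) by (simp add: diff_divide_distrib)
      then show ?thesis using mq(1) by (simp add: \<beta>_def i(1) j(1))
    qed
    show ?thesis
    proof (cases "A = B")
      case False
      have "\<delta> \<le> \<bar>sum r A - sum r B - of_int (k * int q - m) / real q\<bar>"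
        by (rule sep) (use i(2) j(2) False mq Q2 in auto)
      then show ?thesis unfolding \<beta> \<delta>1_def by simp
    next
      case True
      then have "\<not> int q dvd m" using mq(5) ij(3) i(1) j(1) by auto
      then have "m \<noteq> k * int q" by auto
      then have "1 \<le> \<bar>k * int q - m\<bar>" by linarith
      then have "1 \<le> \<bar>real_of_int (k * int q - m)\<bar>" by linarith
      then have "1 / real q \<le> \<bar>real_of_int (k * int q - m)\<bar> / real q"
        by (rule divide_right_mono) simp
      also have "\<dots> = \<bar>\<beta> i - \<beta> j - of_int k\<bar>" unfolding \<beta> using True by simp
      finally have "1 / real q \<le> \<bar>\<beta> i - \<beta> j - of_int k\<bar>" .
      moreover have "1 / N \<le> 1 / real q"
        using mq(2,3) Q2 Nk by (intro divide_left_mono) auto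
      ultimately show ?thesis unfolding \<delta>1_def by linarith
    qed
  qed
  have prodform: "exp_sum I c \<beta> (real n) = exp_sum (Pow X) h (sum r) (real n) * of_real G"
    if n: "n \<in> S" for n
  proof -
    have n': "prime n" "Q < real n" using S n QN by auto
    have "exp_sum I c \<beta> (real n) = (\<Sum>A\<in>Pow X. \<Sum>(D, a)\<in>sieve_points z0 Q.
        (h A * cis (2 * pi * real n * sum r A)) * (of_real (sieve_weight D) * cis (2 * pi * real n * fraction_sum D a)))"
      unfolding exp_sum_def I_def sum.cartesian_product
      by (intro sum.cong refl) (auto simp: c_def \<beta>_def distrib_left cis_mult[symmetric])
    also have "\<dots> = exp_sum (Pow X) h (sum r) (real n) *
       (\<Sum>(D, a)\<in>sieve_points z0 Q. of_real (sieve_weight D) * cis (2 * pi * real n * fraction_sum D a))"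
      unfolding exp_sum_def sum_product by (simp add: case_prod_unfold)
    also have "\<dots> = exp_sum (Pow X) h (sum r) (real n) * of_real G"
      unfolding sieve_points_sum_eq[OF n'] G_def ..
    finally show ?thesis .
  qed
  have sqc: "(\<Sum>i\<in>I. (cmod (c i))\<^sup>2) = H * G"
  proof -
    have "(\<Sum>i\<in>I. (cmod (c i))\<^sup>2) = (\<Sum>A\<in>Pow X. \<Sum>(D, a)\<in>sieve_points z0 Q. (cmod (h A))\<^sup>2 * (sieve_weight D)\<^sup>2)"
      unfolding I_def sum.cartesian_product
      by (intro sum.cong refl) (auto simp: c_def norm_mult power_mult_distrib)
    also have "\<dots> = H * (\<Sum>(D, a)\<in>sieve_points z0 Q. (sieve_weight D)\<^sup>2)"
      unfolding H_def sum_product by (simp add: case_prod_unfold)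
    finally show ?thesis by (simp add: sieve_points_square_sum_eq G_def)
  qed
  have finI: "finite I" unfolding I_def using assms(1) by simp
  have "G\<^sup>2 * (\<Sum>p\<in>S. (cmod (exp_sum (Pow X) h (sum r) (real p)))\<^sup>2)
      = (\<Sum>p\<in>S. (cmod (exp_sum I c \<beta> (real p)))\<^sup>2)"
    unfolding sum_distrib_left
    by (intro sum.cong refl) (simp add: prodform norm_mult power_mult_distrib)
  also have "\<dots> \<le> (\<Sum>n=1..K. (cmod (exp_sum I c \<beta> (real n)))\<^sup>2)"
    by (intro sum_mono2) (use S in \<open>auto simp: K_def le_nat_floor dest!: prime_ge_1_nat\<close>)
  also have "\<dots> \<le> (4 * real K + 4 / \<delta>1 + 2) * (H * G)"
    unfolding sqc[symmetric] using finI \<delta>1 sep1 by (rule dual_large_sieve)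
  also have "\<dots> \<le> (9 * (N + 1 / \<delta>)) * (H * G)"
  proof (rule mult_right_mono)
    have x1: "real K \<le> N" unfolding K_def using N by simp
    have x2: "1 / \<delta>1 \<le> N + 1 / \<delta>"
      unfolding \<delta>1_def using assms(6) N by (auto simp: min_def)
    show "4 * real K + 4 / \<delta>1 + 2 \<le> 9 * (N + 1 / \<delta>)"
    proof -
      have "4 / \<delta>1 = 4 * (1 / \<delta>1)" "9 * (N + 1 / \<delta>) = 9 * N + 9 * (1 / \<delta>)" "1 / \<delta> > 0"
        using assms(6) by simp_all
      with x1 x2 N show ?thesis by linarith
    qed
  qed (use H0 G0 in simp)
  finally have "G * (G * (\<Sum>p\<in>S. (cmod (exp_sum (Pow X) h (sum r) (real p)))\<^sup>2)) \<le> G * (9 * (N + 1 / \<delta>) * H)"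
    by (simp add: power2_eq_square mult_ac)
  then have "G * (\<Sum>p\<in>S. (cmod (exp_sum (Pow X) h (sum r) (real p)))\<^sup>2) \<le> 9 * (N + 1 / \<delta>) * H"
    using G0 by simp
  then have main: "(\<Sum>p\<in>S. (cmod (exp_sum (Pow X) h (sum r) (real p)))\<^sup>2) \<le> 9 * (N + 1 / \<delta>) * H * (1 / G)"
    using G0 by (simp add: field_simps)
  \<comment> \<open>The 44 is twice 22, since ln Q is only half of \<kappa> ln N. With the factor 9
    above it gives 396, rounded up to 400.\<close>
  have "1 / G \<le> 44 * ln z0 / (\<kappa> * ln N)"
  proof (rule mult_imp_le_div_pos)
    show "1 / G * (\<kappa> * ln N) \<le> 44 * ln z0"
      using G1 G0 by (simp add: lnQ pos_divide_le_eq mult_ac)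
  qed (use assms(4) lnN in simp)
  then have "9 * (N + 1 / \<delta>) * H * (1 / G) \<le> 9 * (N + 1 / \<delta>) * H * (44 * ln z0 / (\<kappa> * ln N))"
    using N assms(6) H0 by (intro mult_left_mono) auto
  also have "\<dots> = 396 * ((N + 1 / \<delta>) * ln z0 / (\<kappa> * ln N) * H)" by simp
  also have "\<dots> \<le> 400 * ((N + 1 / \<delta>) * ln z0 / (\<kappa> * ln N) * H)"
    using N assms(4,6) H0 lnz lnN by (intro mult_right_mono mult_nonneg_nonneg divide_nonneg_nonneg) auto
  also have "\<dots> = 400 * (N + 1 / \<delta>) * ln z0 / (\<kappa> * ln N) * H" by simp
  finally show ?thesis using main unfolding H_def by (rule order_trans[rotated])
qed

section \<open>Riesz products\<close>

text \<open>By convexity exp lies below its chord on [-s, s], whose value at s cos y is cosh s +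
  sinh s cos y. The half-angle formulas make this a squared modulus.\<close>

lemma exp_times_cos_le:
  assumes "s \<ge> (0::real)"
  shows "exp (s * cos y) \<le> (cmod (of_real (cosh (s / 2)) + of_real (sinh (s / 2)) * cis y))\<^sup>2"
proof -
  have conv: "convex_on UNIV (exp :: real \<Rightarrow> real)"
    by (rule f''_ge0_imp_convex) (auto intro!: derivative_eq_intros)
  define c where "c = cos y"
  have c: "- 1 \<le> c" "c \<le> 1" by (simp_all add: c_def)
  have "exp ((1 - (1 + c) / 2) *\<^sub>R (- s) + ((1 + c) / 2) *\<^sub>R s)
      \<le> (1 - (1 + c) / 2) * exp (- s) + ((1 + c) / 2) * exp s"
    by (rule convex_onD[OF conv]) (use c in auto)
  also have "(1 - (1 + c) / 2) *\<^sub>R (- s) + ((1 + c) / 2) *\<^sub>R s = s * cos y"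
    by (simp add: c_def field_simps)
  also have "(1 - (1 + c) / 2) * exp (- s) + ((1 + c) / 2) * exp s = cosh s + sinh s * cos y"
    by (simp add: c_def cosh_field_def sinh_field_def field_simps)
  also have "\<dots> = (cosh (s / 2))\<^sup>2 + (sinh (s / 2))\<^sup>2 + 2 * sinh (s / 2) * cosh (s / 2) * cos y"
    using cosh_double[of "s / 2"] sinh_double[of "s / 2"] by simp
  also have "\<dots> = (cosh (s / 2) + sinh (s / 2) * cos y)\<^sup>2 + (sinh (s / 2) * sin y)\<^sup>2"
    using sin_cos_squared_add[of y] by algebra
  also have "\<dots> = (cmod (of_real (cosh (s / 2)) + of_real (sinh (s / 2)) * cis y))\<^sup>2"
    unfolding cmod_power2 by simp
  finally show ?thesis .
qed

text \<open>The quotient of the two sides is nonincreasing, because sinh u \<le> u cosh u. This is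
  the sub-Gaussian bound that makes the mass of the Riesz product depend only on the sum of squares
  of the coefficients.\<close>

lemma cosh_le_exp_square:
  assumes "s \<ge> (0::real)"
  shows "cosh s \<le> exp (s\<^sup>2 / 2)"
proof -
  have 1: "sinh x \<le> x * cosh x" if "x \<ge> 0" for x :: real
  proof -
    have "0 * cosh 0 - sinh 0 \<le> x * cosh x - sinh x"
    proof (rule DERIV_nonneg_imp_nondecreasing[OF that])
      fix u :: real assume "0 \<le> u" "u \<le> x"
      then show "\<exists>d. ((\<lambda>x. x * cosh x - sinh x) has_real_derivative d) (at u) \<and> 0 \<le> d"
        by (intro exI[of _ "u * sinh u"]) (auto intro!: derivative_eq_intros)
    qed
    then show ?thesis by simp
  qed
  have "cosh s * exp (- (s\<^sup>2 / 2)) \<le> cosh 0 * exp (- (0\<^sup>2 / 2))"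
  proof (rule DERIV_nonpos_imp_nonincreasing[OF assms])
    fix u :: real assume u: "0 \<le> u" "u \<le> s"
    have "(sinh u - u * cosh u) * exp (- (u\<^sup>2 / 2)) \<le> 0"
      using 1[OF u(1)] by (intro mult_nonpos_nonneg) auto
    moreover have "((\<lambda>x. cosh x * exp (- (x\<^sup>2 / 2))) has_real_derivative (sinh u - u * cosh u) * exp (- (u\<^sup>2 / 2))) (at u)"
      by (auto intro!: derivative_eq_intros simp: algebra_simps)
    ultimately show "\<exists>d. ((\<lambda>x. cosh x * exp (- (x\<^sup>2 / 2))) has_real_derivative d) (at u) \<and> d \<le> 0"
      by blast
  qed
  then show ?thesis by (simp add: exp_minus field_simps)
qed

text \<open>Each factor \<open>cosh s + sinh s cos y\<close> equals \<open>|cosh(s/2) + sinh(s/2) e\<^bsup>iy\<^esup>|\<^sup>2\<close>; expanding the product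
  of these square roots over \<open>X\<close> makes the subset sums of \<open>X\<close> the only frequencies.\<close>

definition riesz_coeff :: "'x set \<Rightarrow> ('x \<Rightarrow> complex) \<Rightarrow> 'x set \<Rightarrow> complex" where
  "riesz_coeff X b A = (\<Prod>x\<in>A. of_real (sinh (cmod (b x) / 2)) * cis (Arg (b x)))
     * (\<Prod>x\<in>X - A. of_real (cosh (cmod (b x) / 2)))"

lemma exp_Re_exp_sum_le:
  assumes "finite X"
  shows "exp (Re (exp_sum X b r y)) \<le> (cmod (exp_sum (Pow X) (riesz_coeff X b) (sum r) y))\<^sup>2"
proof -
  define u where "u x = complex_of_real (cosh (cmod (b x) / 2))" for x
  define v where "v x = complex_of_real (sinh (cmod (b x) / 2)) * cis (Arg (b x)) * cis (2 * pi * y * r x)" for x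
  have cis_sum: "cis (2 * pi * y * sum r A) = (\<Prod>x\<in>A. cis (2 * pi * y * r x))" if "finite A" for A
    using that by (induction A rule: finite_induct) (simp_all add: distrib_left cis_mult[symmetric])
  have "exp (Re (exp_sum X b r y)) = (\<Prod>x\<in>X. exp (Re (b x * cis (2 * pi * y * r x))))"
    unfolding exp_sum_def using assms by (simp add: exp_sum)
  also have "\<dots> \<le> (\<Prod>x\<in>X. (cmod (u x + v x))\<^sup>2)"
  proof (intro prod_mono conjI)
    fix x
    have "b x * cis (2 * pi * y * r x) = of_real (cmod (b x)) * cis (Arg (b x) + 2 * pi * y * r x)"
      using rcis_cmod_Arg[of "b x"] by (metis cis_mult mult.assoc rcis_def)
    then have "Re (b x * cis (2 * pi * y * r x)) = cmod (b x) * cos (Arg (b x) + 2 * pi * y * r x)"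
      by simp
    also have "exp \<dots> \<le> (cmod (u x + v x))\<^sup>2"
      using exp_times_cos_le[of "cmod (b x)" "Arg (b x) + 2 * pi * y * r x"]
      by (simp add: u_def v_def cis_mult mult.assoc)
    finally show "exp (Re (b x * cis (2 * pi * y * r x))) \<le> (cmod (u x + v x))\<^sup>2" .
  qed simp
  also have "\<dots> = (cmod (\<Prod>x\<in>X. v x + u x))\<^sup>2"
    by (simp add: prod_norm[symmetric] prod_power_distrib add.commute)
  also have "(\<Prod>x\<in>X. v x + u x) = (\<Sum>A\<in>Pow X. prod v A * prod u (X - A))"
    by (rule prod_add[OF assms])
  also have "\<dots> = exp_sum (Pow X) (riesz_coeff X b) (sum r) y"
    unfolding exp_sum_def
  proof (intro sum.cong refl)
    fix A assume "A \<in> Pow X"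
    then have "finite A" using assms finite_subset by blast
    then show "prod v A * prod u (X - A) = riesz_coeff X b A * cis (2 * pi * y * sum r A)"
      unfolding cis_sum[OF \<open>finite A\<close>] v_def u_def riesz_coeff_def prod.distrib by (simp only: mult_ac)
  qed
  finally show ?thesis .
qed

text \<open>The squared coefficients factor over \<open>X\<close>, and sinh^2(s/2) + cosh^2(s/2) =
  cosh s.\<close>

lemma sum_riesz_coeff_le:
  assumes "finite X"
  shows "(\<Sum>A\<in>Pow X. (cmod (riesz_coeff X b A))\<^sup>2) \<le> exp ((\<Sum>x\<in>X. (cmod (b x))\<^sup>2) / 2)"
proof -
  have "(\<Sum>A\<in>Pow X. (cmod (riesz_coeff X b A))\<^sup>2)
      = (\<Sum>A\<in>Pow X. (\<Prod>x\<in>A. (sinh (cmod (b x) / 2))\<^sup>2) * (\<Prod>x\<in>X - A. (cosh (cmod (b x) / 2))\<^sup>2))"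
    unfolding riesz_coeff_def norm_mult prod_norm[symmetric] power_mult_distrib prod_power_distrib
    by simp
  also have "\<dots> = (\<Prod>x\<in>X. (sinh (cmod (b x) / 2))\<^sup>2 + (cosh (cmod (b x) / 2))\<^sup>2)"
    by (rule prod_add[OF assms, symmetric])
  also have "\<dots> = (\<Prod>x\<in>X. cosh (cmod (b x)))"
  proof (intro prod.cong refl)
    fix x show "(sinh (cmod (b x) / 2))\<^sup>2 + (cosh (cmod (b x) / 2))\<^sup>2 = cosh (cmod (b x))"
      using cosh_double[of "cmod (b x) / 2"] by simp
  qed
  also have "\<dots> \<le> (\<Prod>x\<in>X. exp ((cmod (b x))\<^sup>2 / 2))"
    by (intro prod_mono conjI cosh_le_exp_square) auto
  also have "\<dots> = exp ((\<Sum>x\<in>X. (cmod (b x))\<^sup>2) / 2)"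
    using assms by (simp add: exp_sum sum_divide_distrib)
  finally show ?thesis .
qed

section \<open>From exponential moments to second moments\<close>

lemma sum_square_le_of_sum_exp_le:
  fixes y :: "'i \<Rightarrow> real"
  assumes "finite S" "U \<ge> 0" "(\<Sum>i\<in>S. exp \<bar>y i\<bar>) \<le> real (card S) * exp U"
  shows "(\<Sum>i\<in>S. (y i)\<^sup>2) \<le> real (card S) * (U\<^sup>2 + 2 * U + 2)"
proof -
  have pt: "(y i)\<^sup>2 \<le> U\<^sup>2 + 2 * (1 + U) * (exp \<bar>y i\<bar> * exp (- U))" for i
  proof (cases "\<bar>y i\<bar> \<le> U")
    case True
    then have "(y i)\<^sup>2 \<le> U\<^sup>2" by (simp add: abs_le_square_iff[symmetric] assms(2))
    then show ?thesis using assms(2) by (simp add: add_increasing2)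
  next
    case False
    \<comment> \<open>Up to the level U the square costs U^2; the excess w is charged to the
      exponential moment, using that w and w^2/2 are both at most exp w.\<close>
    define w where "w = \<bar>y i\<bar> - U"
    have w: "w \<ge> 0" using False by (simp add: w_def)
    have e: "1 + w + w\<^sup>2 / 2 \<le> exp w" by (rule exp_lower_Taylor_quadratic[OF w])
    have w1: "w \<le> exp w" using e zero_le_power2[of w] by linarith
    have w2: "w\<^sup>2 \<le> 2 * exp w" using e w by linarith
    have "(y i)\<^sup>2 = (U + w)\<^sup>2" by (simp add: w_def)
    also have "\<dots> = U\<^sup>2 + 2 * U * w + w\<^sup>2" by (simp add: power2_eq_square algebra_simps)
    also have "\<dots> \<le> U\<^sup>2 + 2 * U * exp w + 2 * exp w"
      using w1 assms(2) w2 by (intro add_mono mult_left_mono) auto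
    also have "\<dots> = U\<^sup>2 + 2 * (1 + U) * exp w" by (simp add: algebra_simps)
    also have "exp w = exp \<bar>y i\<bar> * exp (- U)" by (simp add: w_def mult_exp_exp)
    finally show ?thesis .
  qed
  have "(\<Sum>i\<in>S. (y i)\<^sup>2) \<le> (\<Sum>i\<in>S. U\<^sup>2 + 2 * (1 + U) * (exp \<bar>y i\<bar> * exp (- U)))"
    by (intro sum_mono pt)
  also have "\<dots> = real (card S) * U\<^sup>2 + 2 * (1 + U) * (exp (- U) * (\<Sum>i\<in>S. exp \<bar>y i\<bar>))"
    by (simp add: sum.distrib sum_distrib_left mult_ac)
  also have "\<dots> \<le> real (card S) * U\<^sup>2 + 2 * (1 + U) * (exp (- U) * (real (card S) * exp U))"
    using assms by (intro add_mono mult_left_mono) auto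
  also have "exp (- U) * (real (card S) * exp U) = real (card S)"
    by (simp add: exp_minus)
  finally show ?thesis by (simp add: algebra_simps)
qed

text \<open>The one-sided bound is applied to b and to -b, whose squared norms agree; this is the
  factor 2.\<close>

lemma sum_exp_abs_Re_le:
  fixes X :: "'x set"
  assumes "finite X" "finite S"
    and mean: "\<And>h. (\<Sum>n\<in>S. (cmod (exp_sum (Pow X) h (sum r) (real n)))\<^sup>2) \<le> M * (\<Sum>A\<in>Pow X. (cmod (h A))\<^sup>2)"
    and "M \<ge> 0"
  shows "(\<Sum>n\<in>S. exp \<bar>Re (exp_sum X b r (real n))\<bar>) \<le> 2 * M * exp ((\<Sum>x\<in>X. (cmod (b x))\<^sup>2) / 2)"
proof -
  have one: "(\<Sum>n\<in>S. exp (Re (exp_sum X b' r (real n)))) \<le> M * exp ((\<Sum>x\<in>X. (cmod (b' x))\<^sup>2) / 2)" for b'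
  proof -
    have "(\<Sum>n\<in>S. exp (Re (exp_sum X b' r (real n)))) \<le> (\<Sum>n\<in>S. (cmod (exp_sum (Pow X) (riesz_coeff X b') (sum r) (real n)))\<^sup>2)"
      by (intro sum_mono exp_Re_exp_sum_le assms(1))
    also have "\<dots> \<le> M * (\<Sum>A\<in>Pow X. (cmod (riesz_coeff X b' A))\<^sup>2)" by (rule mean)
    also have "\<dots> \<le> M * exp ((\<Sum>x\<in>X. (cmod (b' x))\<^sup>2) / 2)"
      by (intro mult_left_mono sum_riesz_coeff_le assms)
    finally show ?thesis .
  qed
  have neg: "exp_sum X (\<lambda>x. - b x) r y = - exp_sum X b r y" for y
    by (simp add: exp_sum_def sum_negf)
  have "(\<Sum>n\<in>S. exp \<bar>Re (exp_sum X b r (real n))\<bar>)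
     \<le> (\<Sum>n\<in>S. exp (Re (exp_sum X b r (real n))) + exp (Re (exp_sum X (\<lambda>x. - b x) r (real n))))"
    unfolding neg by (intro sum_mono) (auto simp: abs_if)
  also have "\<dots> \<le> 2 * M * exp ((\<Sum>x\<in>X. (cmod (b x))\<^sup>2) / 2)"
    using one[of b] one[of "\<lambda>x. - b x"] by (simp add: sum.distrib)
  finally show ?thesis .
qed

lemma sum_norm_exp_sum_square_le:
  fixes X :: "'x set"
  assumes "finite X" "finite S" "\<mu> > 0"
    and mean: "\<And>h. (\<Sum>n\<in>S. (cmod (exp_sum (Pow X) h (sum r) (real n)))\<^sup>2) \<le> M * (\<Sum>A\<in>Pow X. (cmod (h A))\<^sup>2)"
    and M: "M \<ge> 0" "2 * M \<le> real (card S) * exp \<mu>"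
  shows "(\<Sum>n\<in>S. (cmod (exp_sum X b r (real n)))\<^sup>2)
    \<le> (4 * \<mu> + 4 + 2 / \<mu>) * real (card S) * (\<Sum>x\<in>X. (cmod (b x))\<^sup>2)"
proof -
  define C where "C = (\<Sum>x\<in>X. (cmod (b x))\<^sup>2)"
  have "C \<ge> 0" unfolding C_def by (intro sum_nonneg) auto
  show ?thesis
  proof (cases "C = 0")
    case True
    then have "\<forall>x\<in>X. b x = 0" unfolding C_def using assms(1) by (subst (asm) sum_nonneg_eq_0_iff) auto
    then have "exp_sum X b r y = 0" for y by (simp add: exp_sum_def)
    then show ?thesis using True by (simp add: C_def)
  next
    case False
    then have C: "C > 0" using \<open>C \<ge> 0\<close> by simp
    \<comment> \<open>The scaling equalises two factors: the Gaussian term exp(t^2 C / 2) becomes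
      exp \<mu>, the bound for 2M/|S|. Hence the exponential moment is at most |S| exp(2 \<mu>), and
      the level is U = 2 \<mu>.\<close>
    define t where "t = sqrt (2 * \<mu> / C)"
    have t: "t > 0" "t\<^sup>2 * C = 2 * \<mu>" using C assms(3) by (simp_all add: t_def)
    have part: "(\<Sum>n\<in>S. (t * Re (\<omega> * exp_sum X b r (real n)))\<^sup>2) \<le> real (card S) * ((2 * \<mu>)\<^sup>2 + 2 * (2 * \<mu>) + 2)"
      if \<omega>: "cmod \<omega> = 1" for \<omega>
    proof (rule sum_square_le_of_sum_exp_le)
      have scale: "exp_sum X (\<lambda>x. of_real t * \<omega> * b x) r y = of_real t * \<omega> * exp_sum X b r y" for y
        by (simp add: exp_sum_def sum_distrib_left mult.assoc)
      have "(\<Sum>x\<in>X. (cmod (of_real t * \<omega> * b x))\<^sup>2) = t\<^sup>2 * C"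
        using t \<omega> by (simp add: C_def norm_mult power_mult_distrib sum_distrib_left)
      then have "(\<Sum>n\<in>S. exp \<bar>Re (of_real t * \<omega> * exp_sum X b r (real n))\<bar>) \<le> 2 * M * exp \<mu>"
        using sum_exp_abs_Re_le[OF assms(1,2) mean M(1), of "\<lambda>x. of_real t * \<omega> * b x"]
        by (simp add: scale t(2))
      also have "\<dots> \<le> real (card S) * exp \<mu> * exp \<mu>"
        by (intro mult_right_mono M) auto
      also have "\<dots> = real (card S) * exp (2 * \<mu>)" by (simp add: mult_exp_exp)
      finally show "(\<Sum>n\<in>S. exp \<bar>t * Re (\<omega> * exp_sum X b r (real n))\<bar>) \<le> real (card S) * exp (2 * \<mu>)"
        by (simp add: mult.assoc)
    qed (use assms in auto)
    \<comment> \<open>Rotating by 1 and by -i reaches the real and the imaginary part with one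
      argument, since a unimodular factor leaves the norm of b unchanged.\<close>
    have sq: "t\<^sup>2 * (cmod z)\<^sup>2 = (t * Re (1 * z))\<^sup>2 + (t * Re ((- \<i>) * z))\<^sup>2" for z
      by (simp add: cmod_power2 power_mult_distrib distrib_left)
    have "t\<^sup>2 * (\<Sum>n\<in>S. (cmod (exp_sum X b r (real n)))\<^sup>2)
       = (\<Sum>n\<in>S. (t * Re (1 * exp_sum X b r (real n)))\<^sup>2) + (\<Sum>n\<in>S. (t * Re ((- \<i>) * exp_sum X b r (real n)))\<^sup>2)"
      unfolding sum_distrib_left sum.distrib[symmetric] sq ..
    also have "\<dots> \<le> real (card S) * ((2 * \<mu>)\<^sup>2 + 2 * (2 * \<mu>) + 2) + real (card S) * ((2 * \<mu>)\<^sup>2 + 2 * (2 * \<mu>) + 2)"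
      by (intro add_mono part) auto
    also have "\<dots> = real (card S) * (2 * \<mu>) * (4 * \<mu> + 4 + 2 / \<mu>)"
      using assms(3) by (simp add: field_simps power2_eq_square)
    also have "\<dots> = t\<^sup>2 * ((4 * \<mu> + 4 + 2 / \<mu>) * real (card S) * C)"
      unfolding t(2)[symmetric] by (simp only: mult_ac)
    finally show ?thesis using t(1) by (simp add: C_def)
  qed
qed

section \<open>The bound over primes\<close>

text \<open>The 800 is twice the constant of the mean value. As 2^8 \<le> 800 L and 800 \<le> 2^10,
  the claim follows from 5 \<le> 14 ln 2 + 5 ln L, and L \<ge> 1/2 leaves 9 ln 2 \<ge> 6 on the
  right.\<close>

lemma second_moment_constant_le:
  fixes L :: real
  assumes "L \<ge> 1 / 2"
  shows "4 * ln (800 * L) + 4 + 2 / ln (800 * L) \<le> 9 * ln (64 * L)" "ln (800 * L) > 0"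
proof -
  have pow2: "ln (2 ^ n) = real n * ln (2::real)" for n by (simp add: ln_realpow)
  have ln2: "2 / 3 \<le> ln (2::real)" by (rule ln2_ge_two_thirds)
  have L: "L > 0" using assms by simp
  have "8 * ln 2 = ln (2 ^ 8 :: real)" by (simp only: pow2)
  also have "\<dots> \<le> ln (800 * L)" using assms by (intro ln_mono) auto
  finally have l: "2 \<le> ln (800 * L)" using ln2 by simp
  then show "ln (800 * L) > 0" by simp
  have "ln (800 * L) = ln 800 + ln L" using L by (simp add: ln_mult)
  also have "ln 800 \<le> ln (2 ^ 10 :: real)" by (intro ln_mono) auto
  finally have 1: "ln (800 * L) \<le> 10 * ln 2 + ln L" by (simp only: pow2) simp
  have 2: "ln (64 * L) = 6 * ln 2 + ln L" using L pow2[of 6] by (simp add: ln_mult)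
  have "- ln 2 = ln (1 / 2 :: real)" by (simp add: ln_div)
  also have "\<dots> \<le> ln L" using assms by (intro ln_mono) auto
  finally have 3: "- ln 2 \<le> ln L" .
  have "2 / ln (800 * L) \<le> 1" using l by simp
  with 1 2 3 ln2 show "4 * ln (800 * L) + 4 + 2 / ln (800 * L) \<le> 9 * ln (64 * L)" by linarith
qed

text \<open>Testing the dual inequality on the conjugates of the values F x and applying
  Cauchy-Schwarz gives W^2 \<le> T |f|^2 W for the left side W; one factor W cancels.\<close>

lemma dual_bound_imp_primal_bound:
  fixes X :: "'x set" and f :: "nat \<Rightarrow> complex"
  assumes "finite X" "finite S" "T \<ge> 0"
    and dual: "\<And>b. (\<Sum>n\<in>S. (cmod (exp_sum X b r (real n)))\<^sup>2) \<le> T * (\<Sum>x\<in>X. (cmod (b x))\<^sup>2)"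
  shows "(\<Sum>x\<in>X. (cmod (\<Sum>n\<in>S. f n * cis (2 * pi * real n * r x)))\<^sup>2) \<le> T * (\<Sum>n\<in>S. (cmod (f n))\<^sup>2)"
proof -
  define F where "F x = (\<Sum>n\<in>S. f n * cis (2 * pi * real n * r x))" for x
  define W where "W = (\<Sum>x\<in>X. (cmod (F x))\<^sup>2)"
  define G where "G n = exp_sum X (\<lambda>x. cnj (F x)) r (real n)" for n
  have W0: "W \<ge> 0" unfolding W_def by (intro sum_nonneg) auto
  have l0: "0 \<le> (\<Sum>n\<in>S. (cmod (f n))\<^sup>2)" by (intro sum_nonneg) auto
  have "complex_of_real W = (\<Sum>x\<in>X. F x * cnj (F x))"
    by (simp only: W_def of_real_sum complex_norm_square)
  also have "\<dots> = (\<Sum>x\<in>X. \<Sum>n\<in>S. f n * (cnj (F x) * cis (2 * pi * real n * r x)))"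
    by (intro sum.cong refl, subst F_def, subst sum_distrib_right) (intro sum.cong refl, simp only: mult_ac)
  also have "\<dots> = (\<Sum>n\<in>S. \<Sum>x\<in>X. f n * (cnj (F x) * cis (2 * pi * real n * r x)))"
    by (rule sum.swap)
  also have "\<dots> = (\<Sum>n\<in>S. f n * G n)"
    by (simp only: G_def exp_sum_def sum_distrib_left)
  finally have "W = cmod (\<Sum>n\<in>S. f n * G n)"
    using W0 by (metis abs_of_nonneg norm_of_real)
  also have "\<dots> \<le> (\<Sum>n\<in>S. cmod (f n) * cmod (G n))"
    by (rule order_trans[OF norm_sum]) (simp add: norm_mult)
  finally have "W\<^sup>2 \<le> (\<Sum>n\<in>S. cmod (f n) * cmod (G n))\<^sup>2"
    using W0 by (intro power_mono)
  also have "\<dots> \<le> (\<Sum>n\<in>S. (cmod (f n))\<^sup>2) * (\<Sum>n\<in>S. (cmod (G n))\<^sup>2)"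
    by (rule Cauchy_Schwarz_ineq_sum)
  also have "\<dots> \<le> (\<Sum>n\<in>S. (cmod (f n))\<^sup>2) * (T * (\<Sum>x\<in>X. (cmod (cnj (F x)))\<^sup>2))"
    unfolding G_def by (intro mult_left_mono dual l0)
  also have "(\<Sum>x\<in>X. (cmod (cnj (F x)))\<^sup>2) = W" by (simp add: W_def)
  finally have *: "W * W \<le> (T * (\<Sum>n\<in>S. (cmod (f n))\<^sup>2)) * W"
    by (simp only: power2_eq_square mult_ac)
  have "W \<le> T * (\<Sum>n\<in>S. (cmod (f n))\<^sup>2)"
  proof (cases "W = 0")
    case True
    then show ?thesis using l0 assms(3) by simp
  next
    case False
    then have "W > 0" using W0 by simp
    then show ?thesis using * mult_right_le_imp_le by blast
  qed
  then show ?thesis by (simp add: W_def F_def)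
qed

section \<open>Passing from R/Z to real representatives\<close>

lemma to_mod_one_rep_mod_one [simp]: "to_mod_one (rep_mod_one x) = x"
  by (rule Quotient3_abs_rep[OF Quotient3_real_mod_one])

lemma to_mod_one_sum:
  assumes "finite A"
  shows "to_mod_one (sum rep_mod_one A) = \<Sum>A"
  using assms
proof (induction A rule: finite_induct)
  case empty
  then show ?case by (simp add: zero_real_mod_one_def)
next
  case (insert x A)
  then show ?case by (simp add: plus_real_mod_one.abs_eq[symmetric])
qed

lemma e_circle_nat_mult: "e_circle (nat_mult n x) = cis (2 * pi * real n * rep_mod_one x)"
proof -
  have "e_circle (nat_mult n (to_mod_one (rep_mod_one x))) = cis (2 * pi * real n * rep_mod_one x)"
    unfolding nat_mult.abs_eq e_circle.abs_eq cis_conv_exp by (simp add: mult_ac)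
  then show ?thesis by simp
qed

lemma dist_to_zero_le: "dist_to_zero (to_mod_one u) \<le> \<bar>u\<bar>"
proof -
  have "(INF k :: int. \<bar>u - of_int k\<bar>) \<le> \<bar>u - of_int 0\<bar>"
    by (rule cINF_lower) (auto intro!: bdd_belowI[of _ 0])
  then show ?thesis by (simp add: dist_to_zero.abs_eq)
qed

lemma coprime_primorial_below:
  assumes "\<And>p. prime p \<Longrightarrow> p dvd q \<Longrightarrow> z0 \<le> real p"
  shows "coprime q (primorial_below z0)"
proof (rule ccontr)
  assume "\<not> ?thesis"
  then have "gcd q (primorial_below z0) \<noteq> 1" by (simp add: coprime_iff_gcd_eq_1)
  then obtain p where p: "prime p" "p dvd gcd q (primorial_below z0)"
    using prime_factor_nat by blast
  then have "p dvd \<Prod>{p. prime p \<and> real p < z0}" by (simp add: primorial_below_def)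
  then obtain p' where "prime p'" "real p' < z0" "p dvd p'"
    using prime_dvd_prod_iff[of "{p. prime p \<and> real p < z0}" p "\<lambda>x. x"] p(1) by auto
  then have "real p < z0" using p(1) primes_dvd_imp_eq by blast
  then show False using assms[of p] p by simp
qed

text \<open>The distance in R/Z never exceeds the absolute value of a real lift, here the one built
  from chosen representatives. Since \<open>a\<close> is arbitrary, all integer translates are
  covered.\<close>

lemma delta_star_le:
  assumes "finite X" "A \<subseteq> X" "B \<subseteq> X" "A \<noteq> B" "0 < q" "real q \<le> z"
    "\<And>p. prime p \<Longrightarrow> p dvd q \<Longrightarrow> z0 \<le> real p"
  shows "delta_star X z z0 \<le> ereal \<bar>sum rep_mod_one A - sum rep_mod_one B - of_int a / real q\<bar>"
proof -
  have fin: "finite A" "finite B" using assms(1-3) finite_subset by blast+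
  have "delta_star X z z0 \<le> ereal (dist_to_zero (\<Sum>A - \<Sum>B - to_mod_one (of_int a / of_nat q)))"
    unfolding delta_star_def
    by (rule Inf_lower) (use assms coprime_primorial_below[of q z0] in blast)
  also have "\<Sum>A - \<Sum>B - to_mod_one (of_int a / of_nat q)
      = to_mod_one (sum rep_mod_one A - sum rep_mod_one B - of_int a / real q)"
    by (simp add: to_mod_one_sum[symmetric] fin minus_real_mod_one.abs_eq)
  also have "ereal (dist_to_zero \<dots>) \<le> ereal \<bar>sum rep_mod_one A - sum rep_mod_one B - of_int a / real q\<bar>"
    by (simp add: dist_to_zero_le)
  finally show ?thesis .
qed

theorem theorem1p2:
  fixes X :: "real_mod_one set" and N z0 \<kappa> :: real
    and S :: "nat set" and f :: "nat \<Rightarrow> complex"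
  assumes "finite X"
    and "2 \<le> z0" and "z0 \<le> N"
    and "0 < \<kappa>" and "\<kappa> \<le> 1 / 2"
    and "delta_star X (N powr \<kappa>) z0 > 0"
    and "S \<noteq> {}"
    and "S \<subseteq> {p. prime p \<and> N powr \<kappa> \<le> real p \<and> real p \<le> N}"
    and "{n. f n \<noteq> 0} \<subseteq> S"
  shows "(\<Sum>x\<in>X. (cmod (\<Sum>p | prime p \<and> real p \<le> N. f p * e_circle (nat_mult p x)))\<^sup>2)
     \<le> c_const X S N z0 \<kappa> * real (card S) * l2_norm_sq f
         * ln (8 * N / (real (card S) * ln N))"
proof -
  define E where "E = real_of_ereal (inverse (delta_star X (N powr \<kappa>) z0))"
  define L where "L = (N + E) / (\<kappa> * real (card S) * ln N) * ln z0"
  have N: "N \<ge> 2" using assms by simp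
  have lnN: "ln N > 0" using N by simp
  have finP: "finite {p. prime p \<and> real p \<le> N}"
    by (rule finite_subset[of _ "{..nat \<lfloor>N\<rfloor>}"]) (auto simp: le_nat_floor)
  have SP: "S \<subseteq> {p. prime p \<and> real p \<le> N}" using assms(8) by auto
  have finS: "finite S" by (rule finite_subset[OF SP finP])
  have card: "real (card S) > 0" using finS assms(7) by (simp add: card_gt_0_iff)
  have E0: "E \<ge> 0"
    unfolding E_def by (intro real_of_ereal_pos) (use assms(6) in \<open>simp add: ereal_inverse_nonneg_iff\<close>)
  have ln4: "ln 4 = 2 * ln (2::real)" using ln_realpow[of 2 2] by simp
  \<comment> \<open>Chebyshev's bound on the primes between N powr \<kappa> and N gives \<kappa> |S|
    ln N \<le> N ln 4, and ln 4 = 2 ln 2 \<le> 2 ln z0.\<close>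
  have L: "L \<ge> 1 / 2"
  proof -
    have "real (card S) * ln (N powr \<kappa>) \<le> N * ln 4"
      using N assms by (intro card_primes_times_ln_le) (auto intro: ge_one_powr_ge_zero)
    then have "\<kappa> * real (card S) * ln N \<le> 2 * (N * ln 2)"
      using N by (simp add: ln_powr ln4 mult_ac)
    also have "\<dots> \<le> 2 * ((N + E) * ln z0)"
      using N E0 assms(2) by (intro mult_left_mono mult_mono) auto
    finally have "\<kappa> * real (card S) * ln N \<le> 2 * ((N + E) * ln z0)" .
    then show ?thesis
      unfolding L_def using assms(4) card lnN by (simp add: field_simps)
  qed
  define T where "T = 9 * ln (64 * L) * real (card S)"
  have T0: "T \<ge> 0" unfolding T_def using L by simp
  \<comment> \<open>Division by zero would turn \<open>c_const\<close> into 0, so the cancellation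
    needs this logarithm to be nonzero.\<close>
  have cancel: "ln (8 * N / (real (card S) * ln N)) > 0"
  proof (rule ln_gt_zero)
    have "real (card S) * ln N > 0" using card lnN by simp
    then show "1 < 8 * N / (real (card S) * ln N)"
      using card_primes_times_ln_less[OF N SP] by (simp only: less_divide_eq_1_pos)
  qed
  have rhs: "c_const X S N z0 \<kappa> * real (card S) * l2_norm_sq f * ln (8 * N / (real (card S) * ln N))
      = T * l2_norm_sq f"
  proof -
    have "64 * ((N + E) / (\<kappa> * real (card S) * ln N)) * ln z0 = 64 * L"
      by (simp only: L_def mult.assoc)
    then show ?thesis
      unfolding c_const_def T_def E_def[symmetric] using cancel by simp
  qed
  have l2: "l2_norm_sq f = (\<Sum>n\<in>S. (cmod (f n))\<^sup>2)"
    unfolding l2_norm_sq_def by (rule suminf_finite[OF finS]) (use assms(9) in auto)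
  have lhs: "(\<Sum>p | prime p \<and> real p \<le> N. f p * e_circle (nat_mult p x))
      = (\<Sum>n\<in>S. f n * cis (2 * pi * real n * rep_mod_one x))" for x
    unfolding e_circle_nat_mult by (rule sum.mono_neutral_right[OF finP SP]) (use assms(9) in auto)
  \<comment> \<open>For empty \<open>X\<close> there are no two distinct subsets and
    \<open>delta_star\<close> is infinite; no real \<delta> exists, but the left side is 0.\<close>
  show ?thesis
  proof (cases "X = {}")
    case True
    then show ?thesis unfolding rhs unfolding l2 using T0 by (simp add: sum_nonneg)
  next
    case False
    then obtain x where x: "x \<in> X" by blast
    \<comment> \<open>Comparing a one-point subset with the empty one, for a = 0 and q = 1, shows
      that \<open>delta_star\<close> is finite.\<close>
    have "delta_star X (N powr \<kappa>) z0
        \<le> ereal \<bar>sum rep_mod_one {x} - sum rep_mod_one {} - of_int 0 / real 1\<bar>"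
      using x N assms(1,4) by (intro delta_star_le) (auto intro: ge_one_powr_ge_zero)
    then obtain \<delta> where \<delta>: "delta_star X (N powr \<kappa>) z0 = ereal \<delta>" "\<delta> > 0"
      using assms(6) by (cases "delta_star X (N powr \<kappa>) z0") auto
    have E: "E = 1 / \<delta>" unfolding E_def \<delta>(1) using \<delta>(2) by (simp add: inverse_eq_divide)
    have mean: "(\<Sum>p\<in>S. (cmod (exp_sum (Pow X) h (sum rep_mod_one) (real p)))\<^sup>2)
        \<le> 400 * (N + 1 / \<delta>) * ln z0 / (\<kappa> * ln N) * (\<Sum>A\<in>Pow X. (cmod (h A))\<^sup>2)" for h
    proof (rule prime_mean_value_le[OF assms(1-5) \<delta>(2) _ assms(8)])
      fix A B and a :: int and q :: nat
      assume "A \<subseteq> X" "B \<subseteq> X" "A \<noteq> B" "0 < q" "real q \<le> N powr \<kappa>"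
        "\<And>p. prime p \<Longrightarrow> p dvd q \<Longrightarrow> z0 \<le> real p"
      then have "ereal \<delta> \<le> ereal \<bar>sum rep_mod_one A - sum rep_mod_one B - of_int a / real q\<bar>"
        unfolding \<delta>(1)[symmetric] by (intro delta_star_le assms(1))
      then show "\<delta> \<le> \<bar>sum rep_mod_one A - sum rep_mod_one B - of_int a / real q\<bar>" by simp
    qed
    \<comment> \<open>In this form twice the mean-value constant is |S| * 800 L, so \<mu> = ln(800
      L) is the exact choice in the moment bound.\<close>
    have M: "400 * (N + 1 / \<delta>) * ln z0 / (\<kappa> * ln N) = 400 * L * real (card S)"
      unfolding L_def E using card assms(4) lnN by (simp add: field_simps)
    have dual: "(\<Sum>n\<in>S. (cmod (exp_sum X b rep_mod_one (real n)))\<^sup>2) \<le> T * (\<Sum>x\<in>X. (cmod (b x))\<^sup>2)" for b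
    proof -
      have "(\<Sum>n\<in>S. (cmod (exp_sum X b rep_mod_one (real n)))\<^sup>2)
         \<le> (4 * ln (800 * L) + 4 + 2 / ln (800 * L)) * real (card S) * (\<Sum>x\<in>X. (cmod (b x))\<^sup>2)"
      proof (rule sum_norm_exp_sum_square_le[OF assms(1) finS second_moment_constant_le(2)[OF L] mean])
        show "0 \<le> 400 * (N + 1 / \<delta>) * ln z0 / (\<kappa> * ln N)" unfolding M using L by simp
        show "2 * (400 * (N + 1 / \<delta>) * ln z0 / (\<kappa> * ln N)) \<le> real (card S) * exp (ln (800 * L))"
          unfolding M using L by simp
      qed
      also have "\<dots> \<le> T * (\<Sum>x\<in>X. (cmod (b x))\<^sup>2)"
        unfolding T_def using second_moment_constant_le(1)[OF L]
        by (intro mult_right_mono) (auto intro: sum_nonneg)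
      finally show ?thesis .
    qed
    show ?thesis
      unfolding rhs unfolding l2 lhs by (rule dual_bound_imp_primal_bound[OF assms(1) finS T0 dual])
  qed
qed

end
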